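(* Let $H=(H_n)_{n\ge1}$ be a sequence of graphs without isolated vertices, with $v(H_n)\le n$, $|H_n|\to\infty$, and $p_{1M}(H_n)$ bounded away from one. Suppose further that $H$ is first-moment-stable, and that either $p_{1M}(H_n)\to0$ or $v(H_n)\le n^{o(1)}$. Then, for the model of $H_n$ planted in $G(n,p)$, AoN occurs at the exponential scale if and only if $H$ is first-moment-flat. In this case, AoN at the exponential scale occurs at $p_{\mathrm{AoN}}=p_{1M}(H_n)$.
   Context: Graphs: $v(J)$ is the number of vertices of $J$; $|J|=e(J)$ is the number of edges. $K_n$ is the complete graph on $n$ vertices. Graphs in $K_n$ are identified with vectors in $\{0,1\}^{\binom n2}$ (edge indicators). Planted model: given $H=H_n$, let $\mathcal S$ be the set of copies of $H$ in $K_n$ and $\mathbf P$ the uniform measure on $\mathcal S$. Under $\mathbb P_p$, one observes $\mathbf Y=\mathbf H\cup\mathbf G$, where $\mathbf H\sim\mathbf P$ and $\mathbf G\sim G(n,p)$ is independent of $\mathbf H$. Set $\mathrm{MMSE}_n(p)=\mathbb E_{\mathbb P_p}\big[\|\mathbf H-\mathbb E[\mathbf H\mid\mathbf Y]\|_2^2\big]\in[0,e(H)]$. AoN at the exponential scale with critical probability $p_{\mathrm{AoN}}=p_{\mathrm{AoN}}(n)\in(0,1)$, where $p_{\mathrm{AoN}}$ is required to stay bounded away from one: for every constant $\epsilon>0$, $\lim_{n\to\infty}\mathrm{MMSE}_n(p)/e(H_n)=1$ for all $p=p_n\in[0,1]$ with $p_n\ge(p_{\mathrm{AoN}})^{1-\epsilon}$,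 and $\lim_{n\to\infty}\mathrm{MMSE}_n(p)/e(H_n)=0$ for all $p=p_n\in[0,1]$ with $p_n\le(p_{\mathrm{AoN}})^{1+\epsilon}$. AoN occurs at the exponential scale if this holds for some such sequence $p_{\mathrm{AoN}}$. Thresholds: for a graph $J$ with at least one edge, $M_J=\frac{n!/(n-v(J))!}{|\mathrm{Aut}(J)|}$ is the number of copies of $J$ in $K_n$, and $p_{1M}(J)=M_J^{-1/e(J)}$. For $q\in[0,1]$, $\psi_q(H)=\max\{p_{1M}(J): J\subseteq H,\ |J|\ge\max\{1,q|H|\}\}$ and $\lambda_q(H)=\log\frac1{\psi_q(H)}$. First-moment-stable: $\lim_{q\uparrow1}\lambda_q(H_n)/\lambda_1(H_n)=1$ uniformly in $n$ (informally: if $|J|=|H|(1-o(1))$ then $p_{1M}(J)\le p_{1M}(H)^{1-o(1)}$). First-moment-flat: $\lambda_q(H_n)/\lambda_{q'}(H_n)=1+o_n(1)$ for all $q,q'\in(0,1)$. *)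

theory Defs
  imports
    "HOL-Probability.Probability"
    "HOL-Probability.Product_PMF"
    "HOL-Combinatorics.Permutations"
    "HOL-Library.Ramsey"
begin

section \<open>Finite simple graphs\<close>

datatype 'a graph = Graph (verts: "'a set") (edges: "'a set set")

definition simple_graph :: "'a graph \<Rightarrow> bool" where
  "simple_graph G \<longleftrightarrow> finite (verts G) \<and> edges G \<subseteq> nsets (verts G) 2"

definition no_isolated_vertices :: "'a graph \<Rightarrow> bool" where
  "no_isolated_vertices G \<longleftrightarrow> (\<forall>x \<in> verts G. \<exists>e \<in> edges G. x \<in> e)"

definition num_verts :: "'a graph \<Rightarrow> nat" where
  "num_verts G = card (verts G)"

definition num_edges :: "'a graph \<Rightarrow> nat" where
  "num_edges G = card (edges G)"

definition complete_graph :: "nat \<Rightarrow> nat graph" where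
  "complete_graph n = Graph {..<n} (nsets {..<n} 2)"

definition subgraph :: "'a graph \<Rightarrow> 'a graph \<Rightarrow> bool" where
  "subgraph J G \<longleftrightarrow> simple_graph J \<and> verts J \<subseteq> verts G \<and> edges J \<subseteq> edges G"

definition isomorphic :: "'a graph \<Rightarrow> 'b graph \<Rightarrow> bool" where
  "isomorphic G G' \<longleftrightarrow>
     (\<exists>f. bij_betw f (verts G) (verts G') \<and> (\<lambda>e. f ` e) ` edges G = edges G')"

text \<open>Since \<^const>\<open>permutes\<close> forces a function to be the identity outside the vertex set,
  every automorphism is counted exactly once.\<close>

definition automorphisms :: "'a graph \<Rightarrow> ('a \<Rightarrow> 'a) set" where
  "automorphisms G = {f. f permutes verts G \<and> (\<lambda>e. f ` e) ` edges G = edges G}"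

definition copies :: "nat \<Rightarrow> 'a graph \<Rightarrow> nat graph set" where
  "copies n H = {J. subgraph J (complete_graph n) \<and> isomorphic H J}"


section \<open>The planted model\<close>

text \<open>A graph in \<open>K\<^sub>n\<close> is identified with its set of edges.\<close>

definition gnp_pmf :: "nat \<Rightarrow> real \<Rightarrow> nat set set pmf" where
  "gnp_pmf n p =
     map_pmf (\<lambda>b. {e \<in> edges (complete_graph n). b e})
       (Pi_pmf (edges (complete_graph n)) False (\<lambda>_. bernoulli_pmf p))"

text \<open>The joint law of the planted copy and the observation \<open>Y\<close>, as a pair of edge sets.\<close>

definition planted_pmf :: "nat \<Rightarrow> 'a graph \<Rightarrow> real \<Rightarrow> (nat set set \<times> nat set set) pmf" where
  "planted_pmf n H p =
     map_pmf (\<lambda>(S, G). (edges S, edges S \<union> G))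
       (pair_pmf (pmf_of_set (copies n H)) (gnp_pmf n p))"

text \<open>The \<open>e\<close>-coordinate of the conditional expectation of the planted vector given \<open>Y = y\<close>.
  It is meaningful only when \<open>Y = y\<close> has positive probability, which is the only case
  that contributes to the expectation in \<open>MMSE\<close>.\<close>

definition posterior_mean ::
  "nat \<Rightarrow> 'a graph \<Rightarrow> real \<Rightarrow> nat set set \<Rightarrow> nat set \<Rightarrow> real" where
  "posterior_mean n H p y e =
     measure_pmf.expectation (cond_pmf (planted_pmf n H p) {\<omega>. snd \<omega> = y})
       (\<lambda>\<omega>. indicator (fst \<omega>) e)"

definition MMSE :: "nat \<Rightarrow> 'a graph \<Rightarrow> real \<Rightarrow> real" where
  "MMSE n H p =
     measure_pmf.expectation (planted_pmf n H p)
       (\<lambda>(h, y). \<Sum>e \<in> edges (complete_graph n). (indicator h e - posterior_mean n H p y e)\<^sup>2)"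


section \<open>All-or-nothing at the exponential scale\<close>

text \<open>A graph sequence is a function on \<open>nat\<close>. Conditions on a single \<open>n\<close> are imposed for
  all sufficiently large \<open>n\<close>: for \<open>n = 1\<close>, for instance, a graph without isolated vertices
  on at most \<open>n\<close> vertices has no edges, and its first moment threshold is undefined.\<close>

definition bounded_away_from_one :: "(nat \<Rightarrow> real) \<Rightarrow> bool" where
  "bounded_away_from_one p \<longleftrightarrow> (\<exists>c<1. \<forall>\<^sub>F n in sequentially. p n \<le> c)"

definition AoN_at :: "(nat \<Rightarrow> 'a graph) \<Rightarrow> (nat \<Rightarrow> real) \<Rightarrow> bool" where
  "AoN_at H pc \<longleftrightarrow>
     (\<forall>\<^sub>F n in sequentially. 0 < pc n \<and> pc n < 1) \<and>
     bounded_away_from_one pc \<and>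
     (\<forall>\<epsilon>>0.
       (\<forall>p. (\<forall>n. 0 \<le> p n \<and> p n \<le> 1) \<and> (\<forall>\<^sub>F n in sequentially. p n \<ge> pc n powr (1 - \<epsilon>))
          \<longrightarrow> (\<lambda>n. MMSE n (H n) (p n) / real (num_edges (H n))) \<longlonglongrightarrow> 1) \<and>
       (\<forall>p. (\<forall>n. 0 \<le> p n \<and> p n \<le> 1) \<and> (\<forall>\<^sub>F n in sequentially. p n \<le> pc n powr (1 + \<epsilon>))
          \<longrightarrow> (\<lambda>n. MMSE n (H n) (p n) / real (num_edges (H n))) \<longlonglongrightarrow> 0))"

definition AoN_occurs :: "(nat \<Rightarrow> 'a graph) \<Rightarrow> bool" where
  "AoN_occurs H \<longleftrightarrow> (\<exists>pc. AoN_at H pc)"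


section \<open>First moment thresholds\<close>

definition copy_count :: "nat \<Rightarrow> 'a graph \<Rightarrow> real" where
  "copy_count n J = (fact n / fact (n - num_verts J)) / real (card (automorphisms J))"

definition p_1M :: "nat \<Rightarrow> 'a graph \<Rightarrow> real" where
  "p_1M n J = copy_count n J powr (- 1 / real (num_edges J))"

definition psi :: "nat \<Rightarrow> real \<Rightarrow> 'a graph \<Rightarrow> real" where
  "psi n q H = Max (p_1M n ` {J. subgraph J H \<and> real (num_edges J) \<ge> max 1 (q * real (num_edges H))})"

definition lambda :: "nat \<Rightarrow> real \<Rightarrow> 'a graph \<Rightarrow> real" where
  "lambda n q H = ln (1 / psi n q H)"

definition first_moment_stable :: "(nat \<Rightarrow> 'a graph) \<Rightarrow> bool" where
  "first_moment_stable H \<longleftrightarrow>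
     (\<exists>N. uniform_limit {N..} (\<lambda>q n. lambda n q (H n) / lambda n 1 (H n)) (\<lambda>_. 1) (at_left 1))"

definition first_moment_flat :: "(nat \<Rightarrow> 'a graph) \<Rightarrow> bool" where
  "first_moment_flat H \<longleftrightarrow>
     (\<forall>q \<in> {0<..<1}. \<forall>q' \<in> {0<..<1}.
        (\<lambda>n. lambda n q (H n) / lambda n q' (H n)) \<longlonglongrightarrow> 1)"

end

theory Submission
  imports Defs "HOL-Real_Asymp.Real_Asymp"
begin

text \<open>
Write \<open>k = e(H)\<close>, let \<open>M\<close> be the number of copies of \<open>H\<close> in \<open>K\<^sub>n\<close>, so that
\<open>P = p\<^sub>1\<^sub>M(H) = M powr (-1/k)\<close>, and let \<open>Z(y)\<close> be the number of copies contained in \<open>y\<close>.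
Given \<open>Y = y\<close> the planted copy is uniform among those \<open>Z(y)\<close> copies, so \<open>MMSE\<close> is the mean of
\<open>k - |h \<inter> h'|\<close>, where \<open>h\<close> is the planted copy and \<open>h'\<close> an independent posterior sample
(\<open>MMSE_eq_mmse\<close>). Everything is thus a question about the overlap \<open>|h \<inter> h'|\<close>, and three first moment
computations answer it.

\<^item> Counting overlaps (\<open>overlap_boundI\<close>). If every \<open>J \<subseteq> H\<close> with at least \<open>qk\<close> edges satisfies
  \<open>p\<^sub>1\<^sub>M(J) \<le> P powr (1 - o(1))\<close>, then each copy meets at most \<open>M P powr (l - o(k))\<close> copies in exactly
  \<open>l \<ge> qk\<close> edges. By symmetry a copy of \<open>J\<close> lies in a fraction at most \<open>(k choose l) / M\<^sub>J\<close> of all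
  copies of \<open>H\<close>, and summing over the at most \<open>2^k\<close> choices of \<open>J\<close> costs only \<open>P powr (-o(k))\<close> if \<open>P \<rightarrow> 0\<close>.
  If instead \<open>v(H) \<le> n powr o(1)\<close>, one sums over the common vertices, for which the cost is
  \<open>v(H)\<close> to a power that is negligible against the same power of \<open>n\<close>.

\<^item> Large overlap is unlikely for \<open>p \<ge> P powr (1 - \<epsilon>)\<close> (\<open>mmse_ge\<close>, \<open>MMSE_ratio_ge\<close>). The planted
  law has density \<open>Z / (M p^k)\<close> with respect to \<open>G(n,p)\<close>, so \<open>Z(Y) \<le> t M p^k\<close> has probability at most \<open>t\<close>
  under it. On the complement, the expected number of copies that meet the
  planted one in at least \<open>qk\<close> edges is divided by at least \<open>t M p^k\<close>.

\<^item> Small overlap is unlikely for small \<open>p\<close> (\<open>mmse_le\<close>). By a union bound \<open>Y\<close> contains no copy of \<open>J\<close>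
  that meets the planted copy in few edges, where \<open>J = H\<close> (\<open>MMSE_ratio_le\<close>) or \<open>J\<close> is a subgraph
  with few copies (\<open>MMSE_ratio_le_subgraph\<close>); a sample \<open>h'\<close> contains a copy of \<open>J\<close> inside \<open>Y\<close>.

If \<open>H\<close> is flat, stability extends flatness up to \<open>q = 1\<close>, the overlap count holds for every
\<open>q\<close>, and the last two points give the two halves of AoN at \<open>P\<close> (\<open>flat_imp_AoN\<close>). Conversely, suppose that
\<open>\<lambda>\<^sub>q \<le> (1 - \<epsilon>) \<lambda>\<^sub>1\<close> for infinitely many \<open>n\<close>. At both \<open>p = P powr (1 - \<epsilon>/2)\<close> and
\<open>p = P powr (1 - \<epsilon>/4)\<close> the relative error stays away from 0, by the second point and stability, and, for these
\<open>n\<close>, away from 1, by the third point applied to a maximizing \<open>J\<close>. AoN at \<open>p\<^sub>c\<close> would force both values of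
\<open>p\<close> into the window between \<open>p\<^sub>c powr (1 + e)\<close> and \<open>p\<^sub>c powr (1 - e)\<close>, which is too narrow for small \<open>e\<close>
(\<open>AoN_imp_ratio_one\<close>).
\<close>

section \<open>Copies of a graph\<close>

definition map_graph :: "('a \<Rightarrow> 'b) \<Rightarrow> 'a graph \<Rightarrow> 'b graph" where
  "map_graph f G = Graph (f ` verts G) ((`) f ` edges G)"

text \<open>Extensionality outside \<open>V\<close> makes this set finite and lets each embedding of the vertex set be counted
once.\<close>

definition injections :: "'a set \<Rightarrow> nat \<Rightarrow> ('a \<Rightarrow> nat) set" where
  "injections V n = {f \<in> V \<rightarrow>\<^sub>E {..<n}. inj_on f V}"

lemma verts_map_graph [simp]: "verts (map_graph f G) = f ` verts G"
  and edges_map_graph [simp]: "edges (map_graph f G) = (`) f ` edges G"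
  by (simp_all add: map_graph_def)

lemma simple_graph_edgeD:
  assumes "simple_graph G" "e \<in> edges G"
  shows "e \<subseteq> verts G" "card e = 2" "finite e"
  using assms by (auto simp: simple_graph_def nsets_def)

lemma finite_edges: "simple_graph G \<Longrightarrow> finite (edges G)"
  by (meson finite_imp_finite_nsets finite_subset simple_graph_def)

lemma map_graph_cong:
  assumes "simple_graph G" "\<And>x. x \<in> verts G \<Longrightarrow> f x = g x"
  shows "map_graph f G = map_graph g G"
proof -
  have "(`) f ` edges G = (`) g ` edges G"
    by (intro image_cong refl) (use assms simple_graph_edgeD(1)[OF assms(1)] in blast)
  then show ?thesis using assms(2) by (auto simp: map_graph_def)
qed

lemma map_graph_comp: "map_graph f (map_graph g G) = map_graph (f \<circ> g) G"
  by (simp add: map_graph_def image_image image_comp o_def)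

lemma inj_on_image_edges:
  assumes "simple_graph G" "inj_on f (verts G)"
  shows "inj_on ((`) f) (edges G)"
proof (rule inj_onI)
  fix a b assume "a \<in> edges G" "b \<in> edges G" "f ` a = f ` b"
  then show "a = b"
    using assms simple_graph_edgeD(1)[OF assms(1)] by (meson inj_on_image_eq_iff)
qed

lemma simple_map_graph:
  assumes "simple_graph G" "inj_on f (verts G)"
  shows "simple_graph (map_graph f G)"
proof -
  have "f ` e \<in> nsets (f ` verts G) 2" if "e \<in> edges G" for e
    using simple_graph_edgeD[OF assms(1) that] assms(2)
    by (auto simp: nsets_def card_image inj_on_subset)
  then show ?thesis using assms(1) by (auto simp: simple_graph_def)
qed

lemma copies_eq_image:
  assumes "simple_graph H"
  shows "copies n H = (\<lambda>f. map_graph f H) ` injections (verts H) n"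
proof (intro equalityI subsetI)
  fix S assume S: "S \<in> copies n H"
  then obtain f where f: "bij_betw f (verts H) (verts S)" "(\<lambda>e. f ` e) ` edges H = edges S"
    by (auto simp: copies_def isomorphic_def)
  have vS: "verts S \<subseteq> {..<n}"
    using S by (auto simp: copies_def subgraph_def complete_graph_def)
  let ?g = "restrict f (verts H)"
  have "?g \<in> injections (verts H) n"
    using f(1) vS by (auto simp: injections_def bij_betw_def inj_on_def)
  moreover have "S = map_graph ?g H"
  proof -
    have "map_graph ?g H = map_graph f H"
      by (rule map_graph_cong[OF assms]) auto
    also have "\<dots> = S"
      using f by (cases S) (auto simp: map_graph_def bij_betw_def)
    finally show ?thesis by simp
  qed
  ultimately show "S \<in> (\<lambda>f. map_graph f H) ` injections (verts H) n" by blast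
next
  fix S assume "S \<in> (\<lambda>f. map_graph f H) ` injections (verts H) n"
  then obtain f where f: "f \<in> injections (verts H) n" "S = map_graph f H" by auto
  have inj: "inj_on f (verts H)" and im: "f ` verts H \<subseteq> {..<n}"
    using f(1) by (auto simp: injections_def)
  have s: "simple_graph S" using simple_map_graph[OF assms inj] f(2) by simp
  have "edges S \<subseteq> nsets {..<n} 2"
    using s im nsets_mono[of "verts S" "{..<n}" 2] f(2) by (auto simp: simple_graph_def)
  then have "subgraph S (complete_graph n)"
    using s im f(2) by (auto simp: subgraph_def complete_graph_def)
  moreover have "isomorphic H S"
    unfolding isomorphic_def using inj f(2)
    by (intro exI[of _ f]) (auto simp: bij_betw_def)
  ultimately show "S \<in> copies n H" by (simp add: copies_def)
qed

lemma falling_factorial: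
  assumes "v \<le> n"
  shows "(\<Prod>i<v. real (n - i)) = fact n / fact (n - v)"
  using assms
proof (induction v)
  case (Suc v)
  have "n - v = Suc (n - Suc v)" using Suc.prems by simp
  then have f: "(fact (n - v) :: real) = real (n - v) * fact (n - Suc v)"
    by (simp only: fact_Suc of_nat_mult of_nat_Suc)
  have "(\<Prod>i<Suc v. real (n - i)) = fact n / fact (n - v) * real (n - v)"
    using Suc by simp
  also have "\<dots> = fact n / fact (n - Suc v)"
    unfolding f using Suc.prems by (simp del: of_nat_diff)
  finally show ?case .
qed auto

lemma card_injections:
  assumes "finite V" "card V \<le> n"
  shows "real (card (injections V n)) = fact n / fact (n - card V)"
proof -
  have "card (injections V n) = (\<Prod>i\<in>{0..<card V}. n - i)"
    unfolding injections_def
    using card_inj_on_subset_funcset[of V "{..<n}" V] assms by simp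
  then show ?thesis using falling_factorial[OF assms(2)] by (simp add: lessThan_atLeast0)
qed

lemma finite_injections: "finite V \<Longrightarrow> finite (injections V n)"
  unfolding injections_def by (rule finite_subset[of _ "V \<rightarrow>\<^sub>E {..<n}"]) (auto intro: finite_PiE)

lemma injections_nonempty:
  assumes "finite V" "card V \<le> n"
  shows "injections V n \<noteq> {}"
proof
  assume "injections V n = {}"
  then show False using card_injections[OF assms] by (simp add: field_simps)
qed

text \<open>Two embeddings have the same image exactly when they differ by an automorphism.\<close>

lemma card_fibre:
  assumes "simple_graph H" "g \<in> injections (verts H) n"
  shows "card {f \<in> injections (verts H) n. map_graph f H = map_graph g H} = card (automorphisms H)"
proof -
  let ?V = "verts H"
  let ?F = "{f \<in> injections ?V n. map_graph f H = map_graph g H}"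
  have gi: "inj_on g ?V" using assms(2) by (auto simp: injections_def)
  have "bij_betw (\<lambda>s. restrict (g \<circ> s) ?V) (automorphisms H) ?F"
  proof (rule bij_betw_imageI)
    show "inj_on (\<lambda>s. restrict (g \<circ> s) ?V) (automorphisms H)"
    proof (rule inj_onI)
      fix s t assume st: "s \<in> automorphisms H" "t \<in> automorphisms H"
        and eq: "restrict (g \<circ> s) ?V = restrict (g \<circ> t) ?V"
      have p: "s permutes ?V" "t permutes ?V" using st by (auto simp: automorphisms_def)
      show "s = t"
      proof
        fix x show "s x = t x"
        proof (cases "x \<in> ?V")
          case True
          then have "g (s x) = g (t x)" using fun_cong[OF eq, of x] by simp
          then show ?thesis using gi True p by (meson inj_onD permutes_in_image)
        next
          case False then show ?thesis using p by (simp add: permutes_def)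
        qed
      qed
    qed
    show "(\<lambda>s. restrict (g \<circ> s) ?V) ` automorphisms H = ?F"
    proof (intro equalityI subsetI)
      fix f assume "f \<in> (\<lambda>s. restrict (g \<circ> s) ?V) ` automorphisms H"
      then obtain s where s: "s \<in> automorphisms H" "f = restrict (g \<circ> s) ?V" by auto
      have p: "s permutes ?V" and e: "(\<lambda>e. s ` e) ` edges H = edges H"
        using s by (auto simp: automorphisms_def)
      have gp: "g \<in> ?V \<rightarrow>\<^sub>E {..<n}" using assms(2) by (simp add: injections_def)
      have "inj_on (g \<circ> s) ?V"
        using gi p by (simp add: comp_inj_on permutes_image permutes_inj_on)
      then have "inj_on f ?V" unfolding s(2) by (simp add: inj_on_def)
      moreover have "f \<in> ?V \<rightarrow>\<^sub>E {..<n}"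
        unfolding s(2) using gp p by (auto simp: permutes_in_image)
      ultimately have "f \<in> injections ?V n" by (simp add: injections_def)
      moreover have "map_graph f H = map_graph g (map_graph s H)"
        unfolding map_graph_comp by (rule map_graph_cong[OF assms(1)]) (simp add: s)
      moreover have "map_graph s H = H"
        using e permutes_image[OF p] by (cases H) (simp add: map_graph_def)
      ultimately show "f \<in> ?F" by simp
    next
      fix f assume f: "f \<in> ?F"
      then have fi: "inj_on f ?V" and fe: "f \<in> extensional ?V"
        by (auto simp: injections_def PiE_def)
      have im: "f ` ?V = g ` ?V" and ed: "(`) f ` edges H = (`) g ` edges H"
        using f by (auto simp: map_graph_def)
      define s where "s x = (if x \<in> ?V then the_inv_into ?V g (f x) else x)" for x
      have gs: "g (s x) = f x" "s x \<in> ?V" if "x \<in> ?V" for x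
      proof -
        have "f x \<in> g ` ?V" using that im by blast
        then show "g (s x) = f x" "s x \<in> ?V"
          using that gi by (auto simp: s_def f_the_inv_into_f the_inv_into_into)
      qed
      have "bij_betw s ?V ?V"
      proof -
        have "inj_on s ?V" by (rule inj_onI) (metis gs(1) fi inj_onD)
        moreover have "s ` ?V \<subseteq> ?V" using gs(2) by auto
        moreover have "finite ?V" using assms(1) by (simp add: simple_graph_def)
        ultimately show ?thesis by (simp add: bij_betw_def endo_inj_surj)
      qed
      then have p: "s permutes ?V" by (rule bij_imp_permutes) (simp add: s_def)
      have gse: "(`) g ` ((`) s ` edges H) = (`) g ` edges H"
      proof -
        have "(`) g ` ((`) s ` edges H) = (`) f ` edges H"
        proof -
          have "g ` s ` e = f ` e" if "e \<in> edges H" for e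
            unfolding image_image
            by (intro image_cong refl gs(1)) (use simple_graph_edgeD(1)[OF assms(1) that] in blast)
          then show ?thesis by (simp add: image_image)
        qed
        then show ?thesis using ed by simp
      qed
      have "(`) s ` edges H \<subseteq> Pow ?V" "edges H \<subseteq> Pow ?V"
        using gs(2) simple_graph_edgeD(1)[OF assms(1)] by blast+
      then have "(`) s ` edges H = edges H"
        using inj_on_image_eq_iff[OF inj_on_image_Pow[OF gi]] gse by metis
      then have "s \<in> automorphisms H" using p by (simp add: automorphisms_def)
      moreover have "f = restrict (g \<circ> s) ?V"
        using fe gs(1) by (auto simp: extensional_def fun_eq_iff)
      ultimately show "f \<in> (\<lambda>s. restrict (g \<circ> s) ?V) ` automorphisms H" by blast
    qed
  qed
  then show ?thesis by (simp add: bij_betw_same_card)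
qed

lemma card_automorphisms_pos:
  assumes "simple_graph H" shows "card (automorphisms H) > 0"
proof -
  have "finite (automorphisms H)"
    using assms finite_permutations[of "verts H"]
    by (auto simp: automorphisms_def simple_graph_def)
  moreover have "id \<in> automorphisms H" by (simp add: automorphisms_def permutes_id)
  ultimately show ?thesis by (auto simp: card_gt_0_iff)
qed

lemma copies_finite_nonempty:
  assumes "simple_graph H" "num_verts H \<le> n"
  shows "finite (copies n H)" "copies n H \<noteq> {}"
  using assms finite_injections[of "verts H" n] injections_nonempty[of "verts H" n]
  by (auto simp: copies_eq_image simple_graph_def num_verts_def)

lemma card_copies:
  assumes "simple_graph H" "num_verts H \<le> n"
  shows "real (card (copies n H)) = copy_count n H"
proof -
  let ?I = "injections (verts H) n"
  have fin: "finite (verts H)" using assms by (simp add: simple_graph_def)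
  have "card ?I = (\<Sum>S\<in>copies n H. card {f \<in> ?I. map_graph f H = S})"
    using sum.group[of ?I "copies n H" "\<lambda>f. map_graph f H" "\<lambda>_. 1::nat"]
    by (simp add: copies_eq_image[OF assms(1)] finite_injections[OF fin])
  also have "\<dots> = (\<Sum>S\<in>copies n H. card (automorphisms H))"
    by (intro sum.cong refl) (auto simp: copies_eq_image[OF assms(1)] card_fibre[OF assms(1)])
  finally have "real (card ?I) = real (card (copies n H)) * real (card (automorphisms H))"
    by simp
  then show ?thesis
    using card_injections[OF fin, of n] assms(2) card_automorphisms_pos[OF assms(1)]
    by (simp add: copy_count_def num_verts_def field_simps)
qed

lemma copy_count_pos:
  assumes "simple_graph H" shows "copy_count n H > 0"
  using card_automorphisms_pos[OF assms] by (simp add: copy_count_def)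

lemma copy_count_le_power:
  assumes "simple_graph H" "num_verts H \<le> n"
  shows "copy_count n H \<le> real n ^ num_verts H"
proof -
  have "1 \<le> real (card (automorphisms H))"
    using card_automorphisms_pos[OF assms(1)] by linarith
  then have "copy_count n H \<le> (fact n / fact (n - num_verts H)) / 1"
    unfolding copy_count_def by (intro divide_left_mono) auto
  also have "\<dots> = fact n / fact (n - num_verts H)" by simp
  also have "\<dots> = (\<Prod>i<num_verts H. real (n - i))" using falling_factorial[OF assms(2)] by simp
  also have "\<dots> \<le> (\<Prod>i<num_verts H. real n)" by (intro prod_mono) auto
  finally show ?thesis by simp
qed

lemma copy_simple: "S \<in> copies n H \<Longrightarrow> simple_graph S"
  by (simp add: copies_def subgraph_def)

lemma copy_edges_subset: "S \<in> copies n H \<Longrightarrow> edges S \<subseteq> edges (complete_graph n)"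
  by (simp add: copies_def subgraph_def)

lemma copy_verts_subset: "S \<in> copies n H \<Longrightarrow> verts S \<subseteq> {..<n}"
  by (simp add: copies_def subgraph_def complete_graph_def)

lemma card_copy:
  assumes "simple_graph H" "S \<in> copies n H"
  shows "card (edges S) = num_edges H" "card (verts S) = num_verts H"
proof -
  obtain f where f: "f \<in> injections (verts H) n" "S = map_graph f H"
    using assms copies_eq_image by blast
  have inj: "inj_on f (verts H)" using f by (simp add: injections_def)
  then show "card (edges S) = num_edges H" "card (verts S) = num_verts H"
    using inj_on_image_edges[OF assms(1) inj] f(2)
    by (simp_all add: num_edges_def num_verts_def card_image)
qed

lemma no_isolated_verts_eq:
  assumes "simple_graph H" "no_isolated_vertices H"
  shows "verts H = \<Union>(edges H)"
  using assms simple_graph_edgeD(1)[OF assms(1)] by (auto simp: no_isolated_vertices_def)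

lemma copy_verts_eq:
  assumes "simple_graph H" "no_isolated_vertices H" "S \<in> copies n H"
  shows "verts S = \<Union>(edges S)"
proof -
  obtain f where "S = map_graph f H" using assms copies_eq_image by blast
  then show ?thesis using no_isolated_verts_eq[OF assms(1,2)] by auto
qed

lemma inj_on_edges_copies:
  assumes "simple_graph H" "no_isolated_vertices H"
  shows "inj_on edges (copies n H)"
proof (rule inj_onI)
  fix S T assume "S \<in> copies n H" "T \<in> copies n H" "edges S = edges T"
  then show "S = T"
    using copy_verts_eq[OF assms] by (intro graph.expand) simp
qed

section \<open>How many copies meet a given copy\<close>

text \<open>Counting the pairs in \<open>R\<close> in two ways: by the symmetry assumption every \<open>D\<close> is related to equally many
\<open>x\<close>, so each of these numbers equals the average.\<close>

lemma transitive_double_count: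
  fixes R :: "'x \<Rightarrow> 'o \<Rightarrow> bool"
  assumes "finite X" "finite F"
    and trans: "\<And>D D'. D \<in> F \<Longrightarrow> D' \<in> F \<Longrightarrow>
      \<exists>g. inj_on g X \<and> g ` X \<subseteq> X \<and> (\<forall>x\<in>X. R x D \<longrightarrow> R (g x) D')"
    and K: "\<And>x. x \<in> X \<Longrightarrow> card {D \<in> F. R x D} \<le> K"
    and D: "D \<in> F"
  shows "card {x \<in> X. R x D} * card F \<le> card X * K"
proof -
  have le: "card {x \<in> X. R x D} \<le> card {x \<in> X. R x D'}" if D': "D' \<in> F" for D'
  proof -
    obtain g where g: "inj_on g X" "g ` X \<subseteq> X" "\<forall>x\<in>X. R x D \<longrightarrow> R (g x) D'"
      using trans[OF D D'] by blast
    show ?thesis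
      by (rule card_inj_on_le[of g]) (use g assms(1) in \<open>auto intro: inj_on_subset\<close>)
  qed
  have "card {x \<in> X. R x D} * card F = (\<Sum>D'\<in>F. card {x \<in> X. R x D})" by simp
  also have "\<dots> \<le> (\<Sum>D'\<in>F. card {x \<in> X. R x D'})" by (intro sum_mono le)
  also have "\<dots> = (\<Sum>D'\<in>F. \<Sum>x\<in>X. if R x D' then 1 else 0)"
    using assms(1) by (simp add: sum.If_cases Int_def)
  also have "\<dots> = (\<Sum>x\<in>X. \<Sum>D'\<in>F. if R x D' then 1 else 0)" by (rule sum.swap)
  also have "\<dots> = (\<Sum>x\<in>X. card {D' \<in> F. R x D'})"
    using assms(2) by (simp add: sum.If_cases Int_def)
  also have "\<dots> \<le> (\<Sum>x\<in>X. K)" by (intro sum_mono K)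
  finally show ?thesis by simp
qed

text \<open>Only the sizes of the complements of \<open>A\<close> and of its image matter, and these agree.\<close>

lemma extend_to_permutation:
  assumes "finite B" "A \<subseteq> B" "inj_on f A" "f ` A \<subseteq> B"
  obtains g where "g permutes B" "\<And>x. x \<in> A \<Longrightarrow> g x = f x"
proof -
  have "card (B - A) = card (B - f ` A)"
    using assms by (simp add: card_Diff_subset card_image finite_subset[of A B])
  then obtain h where h: "bij_betw h (B - A) (B - f ` A)"
    using assms(1) by (meson finite_Diff finite_same_card_bij)
  define g where "g x = (if x \<in> A then f x else if x \<in> B then h x else x)" for x
  have "bij_betw g (A \<union> (B - A)) (f ` A \<union> (B - f ` A))"
  proof (rule bij_betw_combine)
    show "bij_betw g A (f ` A)"
      using assms(3) by (simp add: g_def bij_betw_def inj_on_def)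
    have "bij_betw g (B - A) (B - f ` A) \<longleftrightarrow> bij_betw h (B - A) (B - f ` A)"
      by (rule bij_betw_cong) (simp add: g_def)
    then show "bij_betw g (B - A) (B - f ` A)" using h by simp
  qed auto
  moreover have "A \<union> (B - A) = B" "f ` A \<union> (B - f ` A) = B" using assms by auto
  ultimately have "g permutes B"
    by (intro bij_imp_permutes) (use assms(2) in \<open>auto simp: g_def\<close>)
  moreover have "g x = f x" if "x \<in> A" for x using that by (simp add: g_def)
  ultimately show thesis by (rule that)
qed

lemma map_graph_copies:
  assumes "simple_graph H" "g permutes {..<n}"
  shows "inj_on (map_graph g) (copies n H)" "map_graph g ` copies n H \<subseteq> copies n H"
proof -
  have "map_graph (inv g) (map_graph g S) = S" for S :: "nat graph"
    unfolding map_graph_comp using permutes_inv_o(2)[OF assms(2)]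
    by (cases S) (simp add: map_graph_def)
  then show "inj_on (map_graph g) (copies n H)" by (metis inj_onI)
  show "map_graph g ` copies n H \<subseteq> copies n H"
  proof
    fix T assume "T \<in> map_graph g ` copies n H"
    then obtain f where f: "f \<in> injections (verts H) n" "T = map_graph g (map_graph f H)"
      using copies_eq_image[OF assms(1), of n] by auto
    let ?f = "restrict (g \<circ> f) (verts H)"
    have fi: "inj_on f (verts H)" "f \<in> verts H \<rightarrow>\<^sub>E {..<n}"
      using f(1) by (auto simp: injections_def)
    have "inj_on (g \<circ> f) (verts H)"
      using fi(1) permutes_inj[OF assms(2)] by (meson comp_inj_on inj_on_subset subset_UNIV)
    then have "inj_on ?f (verts H)" by (simp add: inj_on_def)
    moreover have "?f \<in> verts H \<rightarrow>\<^sub>E {..<n}"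
    proof
      fix x assume "x \<in> verts H"
      then have "f x \<in> {..<n}" using fi(2) by blast
      then show "?f x \<in> {..<n}"
        using \<open>x \<in> verts H\<close> permutes_in_image[OF assms(2), of "f x"] by simp
    qed simp
    ultimately have "?f \<in> injections (verts H) n" by (simp add: injections_def)
    moreover have "T = map_graph ?f H"
      unfolding f(2) map_graph_comp by (rule map_graph_cong[OF assms(1)]) simp
    ultimately show "T \<in> copies n H" using copies_eq_image[OF assms(1)] by blast
  qed
qed

text \<open>The symmetric group on the vertices of \<open>K\<^sub>n\<close> acts transitively on the copies of \<open>J\<close>. This is what makes
\<open>transitive_double_count\<close> applicable to copies.\<close>

lemma copies_transitive:
  assumes "simple_graph J" "S \<in> copies n J" "T \<in> copies n J"
  obtains g where "g permutes {..<n}" "map_graph g S = T"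
proof -
  obtain a b where a: "a \<in> injections (verts J) n" "S = map_graph a J"
    and b: "b \<in> injections (verts J) n" "T = map_graph b J"
    using assms copies_eq_image[OF assms(1)] by blast
  have ai: "inj_on a (verts J)" and bi: "inj_on b (verts J)"
    and aim: "a ` verts J \<subseteq> {..<n}" and bim: "b ` verts J \<subseteq> {..<n}"
    using a b by (auto simp: injections_def)
  let ?f = "b \<circ> the_inv_into (verts J) a"
  have ba: "?f (a x) = b x" if "x \<in> verts J" for x
    using that ai by (simp add: the_inv_into_f_f)
  have inj: "inj_on ?f (a ` verts J)"
    using ba ai bi unfolding inj_on_def by auto
  have im: "?f ` (a ` verts J) \<subseteq> {..<n}" using ba bim by (auto simp del: comp_apply)
  obtain g where g: "g permutes {..<n}" "\<And>x. x \<in> a ` verts J \<Longrightarrow> g x = ?f x"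
    using extend_to_permutation[OF _ aim inj im] by auto
  have "map_graph g S = T"
    unfolding a b map_graph_comp
  proof (rule map_graph_cong[OF assms(1)])
    fix x assume "x \<in> verts J"
    then show "(g \<circ> a) x = b x" using g(2)[of "a x"] ba by simp
  qed
  with g(1) show thesis by (rule that)
qed

text \<open>Each copy of \<open>H\<close> contains at most one copy of \<open>J\<close> per edge set of the right size, because \<open>J\<close> has no
isolated vertices.\<close>

lemma copies_containing:
  assumes H: "simple_graph H" "num_verts H \<le> n"
    and J: "simple_graph J" "no_isolated_vertices J" "num_verts J \<le> n" "S \<in> copies n J"
  shows "real (card {T \<in> copies n H. edges S \<subseteq> edges T}) * copy_count n J
    \<le> real (card (copies n H)) * real (num_edges H choose num_edges J)"
proof -
  have "card {T \<in> copies n H. edges S \<subseteq> edges T} * card (copies n J)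
      \<le> card (copies n H) * (num_edges H choose num_edges J)"
  proof (rule transitive_double_count)
    show "finite (copies n H)" "finite (copies n J)"
      using copies_finite_nonempty H J by auto
    show "\<exists>g. inj_on g (copies n H) \<and> g ` copies n H \<subseteq> copies n H \<and>
        (\<forall>T\<in>copies n H. edges D \<subseteq> edges T \<longrightarrow> edges D' \<subseteq> edges (g T))"
      if D: "D \<in> copies n J" "D' \<in> copies n J" for D D'
    proof -
      obtain g where g: "g permutes {..<n}" "map_graph g D = D'"
        using copies_transitive[OF J(1) D] .
      have "edges D' \<subseteq> edges (map_graph g T)" if "edges D \<subseteq> edges T" for T
        using image_mono[OF that, of "(`) g"] g(2) by auto
      then show ?thesis using map_graph_copies[OF H(1) g(1)] by blast
    qed
    show "card {D \<in> copies n J. edges D \<subseteq> edges T} \<le> num_edges H choose num_edges J"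
      if T: "T \<in> copies n H" for T
    proof -
      have fT: "finite (edges T)" using T copy_simple finite_edges by blast
      have "card {D \<in> copies n J. edges D \<subseteq> edges T}
          \<le> card {F. F \<subseteq> edges T \<and> card F = num_edges J}"
      proof (rule card_inj_on_le[of edges])
        show "inj_on edges {D \<in> copies n J. edges D \<subseteq> edges T}"
          using inj_on_edges_copies[OF J(1,2)] by (rule inj_on_subset) auto
        show "edges ` {D \<in> copies n J. edges D \<subseteq> edges T}
            \<subseteq> {F. F \<subseteq> edges T \<and> card F = num_edges J}"
          using card_copy(1)[OF J(1)] by auto
        show "finite {F. F \<subseteq> edges T \<and> card F = num_edges J}"
          by (rule finite_subset[of _ "Pow (edges T)"]) (use fT in auto)
      qed
      also have "\<dots> = card (edges T) choose num_edges J" by (rule n_subsets[OF fT])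
      finally show ?thesis using card_copy(1)[OF H(1) T] by simp
    qed
  qed (fact J(4))
  then have "real (card {T \<in> copies n H. edges S \<subseteq> edges T}) * real (card (copies n J))
      \<le> real (card (copies n H)) * real (num_edges H choose num_edges J)"
    by (simp only: of_nat_mult[symmetric] of_nat_le_iff)
  then show ?thesis by (simp add: card_copies[OF J(1,3)])
qed

lemma copies_through_vertices:
  assumes H: "simple_graph H" "num_verts H \<le> n" and D: "D \<subseteq> {..<n}" "card D = m"
  shows "card {T \<in> copies n H. D \<subseteq> verts T} * (n choose m)
    \<le> card (copies n H) * (num_verts H choose m)"
proof -
  let ?F = "{D. D \<subseteq> {..<n} \<and> card D = m}"
  have "card {T \<in> copies n H. D \<subseteq> verts T} * card ?F
      \<le> card (copies n H) * (num_verts H choose m)"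
  proof (rule transitive_double_count)
    show "finite (copies n H)" using copies_finite_nonempty H by auto
    show "finite ?F" by (rule finite_subset[of _ "Pow {..<n}"]) auto
    show "\<exists>g. inj_on g (copies n H) \<and> g ` copies n H \<subseteq> copies n H \<and>
        (\<forall>T\<in>copies n H. D \<subseteq> verts T \<longrightarrow> D' \<subseteq> verts (g T))"
      if D: "D \<in> ?F" "D' \<in> ?F" for D D'
    proof -
      have "finite D" "finite D'" using D by (auto intro: finite_subset)
      then obtain f where f: "bij_betw f D D'"
        using D finite_same_card_bij[of D D'] by auto
      obtain g where g: "g permutes {..<n}" "\<And>x. x \<in> D \<Longrightarrow> g x = f x"
        using extend_to_permutation[of "{..<n}" D f] D f by (auto simp: bij_betw_def)
      have "g ` D = D'" using g(2) f by (simp add: bij_betw_def)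
      then have "D' \<subseteq> verts (map_graph g T)" if "D \<subseteq> verts T" for T
        using that by auto
      then show ?thesis using map_graph_copies[OF H(1) g(1)] by blast
    qed
    show "card {D \<in> ?F. D \<subseteq> verts T} \<le> num_verts H choose m" if T: "T \<in> copies n H" for T
    proof -
      have fT: "finite (verts T)" using copy_simple[OF T] by (simp add: simple_graph_def)
      have "{D \<in> ?F. D \<subseteq> verts T} = {D. D \<subseteq> verts T \<and> card D = m}"
        using copy_verts_subset[OF T] by auto
      then show ?thesis using card_copy(2)[OF H(1) T] n_subsets[OF fT] by simp
    qed
  qed (use D in simp)
  then show ?thesis by (simp add: n_subsets)
qed

text \<open>A set of edges of a copy is pulled back to \<open>H\<close>. Applied to the common edges of two copies, this makes the
first moment thresholds of subgraphs of \<open>H\<close> available.\<close>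

lemma copy_edge_subset:
  assumes "simple_graph H" "S \<in> copies n H" "F \<subseteq> edges S"
  obtains F0 where "F0 \<subseteq> edges H" "card F0 = card F" "card (\<Union>F0) = card (\<Union>F)"
    "Graph (\<Union>F) F \<in> copies n (Graph (\<Union>F0) F0)"
proof -
  obtain f where f: "f \<in> injections (verts H) n" "S = map_graph f H"
    using assms copies_eq_image by blast
  have inj: "inj_on f (verts H)" using f by (simp add: injections_def)
  define F0 where "F0 = {e \<in> edges H. f ` e \<in> F}"
  have F: "F = (`) f ` F0" using assms(3) f(2) by (auto simp: F0_def)
  have F0: "F0 \<subseteq> edges H" by (auto simp: F0_def)
  then have UF0: "\<Union>F0 \<subseteq> verts H" using simple_graph_edgeD(1)[OF assms(1)] by blast
  have s: "simple_graph (Graph (\<Union>F0) F0)"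
  proof -
    have "finite (\<Union>F0)" using UF0 assms(1) finite_subset by (auto simp: simple_graph_def)
    moreover have "F0 \<subseteq> nsets (\<Union>F0) 2"
    proof
      fix e assume e: "e \<in> F0"
      then show "e \<in> nsets (\<Union>F0) 2"
        using F0 simple_graph_edgeD[OF assms(1), of e] by (auto simp: nsets_def)
    qed
    ultimately show ?thesis by (simp add: simple_graph_def)
  qed
  have "card F0 = card F"
    unfolding F using inj_on_subset[OF inj_on_image_edges[OF assms(1) inj] F0]
    by (simp add: card_image)
  moreover have UF: "\<Union>F = f ` \<Union>F0" unfolding F by blast
  then have "card (\<Union>F0) = card (\<Union>F)"
    using inj_on_subset[OF inj UF0] by (simp add: card_image)
  moreover have "Graph (\<Union>F) F \<in> copies n (Graph (\<Union>F0) F0)"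
  proof -
    let ?g = "restrict f (\<Union>F0)"
    have "Graph (\<Union>F) F = map_graph f (Graph (\<Union>F0) F0)"
      by (simp add: map_graph_def F image_Union)
    also have "\<dots> = map_graph ?g (Graph (\<Union>F0) F0)"
      by (rule map_graph_cong[OF s]) simp
    finally have eq: "Graph (\<Union>F) F = map_graph ?g (Graph (\<Union>F0) F0)" .
    have "inj_on ?g (\<Union>F0)" using inj_on_subset[OF inj UF0] by (simp add: inj_on_def)
    moreover have "?g \<in> \<Union>F0 \<rightarrow>\<^sub>E {..<n}"
      using f(1) UF0 unfolding injections_def by fastforce
    ultimately have "?g \<in> injections (\<Union>F0) n" unfolding injections_def by blast
    then show ?thesis unfolding copies_eq_image[OF s] eq by simp
  qed
  ultimately show thesis using F0 that by blast
qed

lemma edge_induced_graph: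
  assumes "simple_graph H" "F \<subseteq> edges H"
  shows "subgraph (Graph (\<Union>F) F) H" "no_isolated_vertices (Graph (\<Union>F) F)"
    "simple_graph (Graph (\<Union>F) F)" "num_verts (Graph (\<Union>F) F) \<le> num_verts H"
proof -
  have U: "\<Union>F \<subseteq> verts H" using assms simple_graph_edgeD(1)[OF assms(1)] by blast
  have fin: "finite (verts H)" using assms by (simp add: simple_graph_def)
  have "F \<subseteq> nsets (\<Union>F) 2"
  proof
    fix e assume "e \<in> F"
    then show "e \<in> nsets (\<Union>F) 2"
      using assms(2) simple_graph_edgeD[OF assms(1), of e] by (auto simp: nsets_def)
  qed
  then show s: "simple_graph (Graph (\<Union>F) F)"
    using U fin finite_subset by (auto simp: simple_graph_def)
  then show "subgraph (Graph (\<Union>F) F) H" using U assms(2) by (simp add: subgraph_def)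
  show "no_isolated_vertices (Graph (\<Union>F) F)" by (auto simp: no_isolated_vertices_def)
  show "num_verts (Graph (\<Union>F) F) \<le> num_verts H"
    using card_mono[OF fin U] by (simp add: num_verts_def)
qed

text \<open>A union bound over the possible sets of common edges. The factor \<open>4^k\<close> is the square of \<open>2^k\<close>: one
factor for the choice of the common edges in \<open>S\<close>, the other for their position in \<open>T\<close>.\<close>

lemma overlap_count_edges:
  assumes H: "simple_graph H" "num_verts H \<le> n" and S: "S \<in> copies n H"
    and B: "0 \<le> B" "\<And>F. F \<subseteq> edges H \<Longrightarrow> card F = l \<Longrightarrow> B \<le> copy_count n (Graph (\<Union>F) F)"
  shows "real (card {T \<in> copies n H. card (edges S \<inter> edges T) = l}) * B
    \<le> real (card (copies n H)) * 4 ^ num_edges H"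
proof -
  let ?k = "num_edges H" let ?M = "real (card (copies n H))"
  let ?Fs = "{F. F \<subseteq> edges S \<and> card F = l}"
  have fS: "finite (edges S)" using S copy_simple finite_edges by blast
  have fin: "finite (copies n H)" using copies_finite_nonempty H by auto
  have finF: "finite ?Fs" by (rule finite_subset[of _ "Pow (edges S)"]) (use fS in auto)
  have one: "real (card {T \<in> copies n H. F \<subseteq> edges T}) * B \<le> ?M * real (?k choose l)"
    if F: "F \<in> ?Fs" for F
  proof -
    have "F \<subseteq> edges S" using F by simp
    then obtain F0 where F0: "F0 \<subseteq> edges H" "card F0 = card F"
        "card (\<Union>F0) = card (\<Union>F)" "Graph (\<Union>F) F \<in> copies n (Graph (\<Union>F0) F0)"
      by (rule copy_edge_subset[OF H(1) S])
    note J = edge_induced_graph[OF H(1) F0(1)]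
    have "real (card {T \<in> copies n H. F \<subseteq> edges T}) * B
        \<le> real (card {T \<in> copies n H. F \<subseteq> edges T}) * copy_count n (Graph (\<Union>F0) F0)"
      using B(2)[OF F0(1)] F0(2) F by (intro mult_left_mono) auto
    also have "\<dots> \<le> ?M * real (?k choose l)"
      using copies_containing[OF H J(3,2) _ F0(4)] J(4) H(2) F0(2) F
      by (simp add: num_edges_def)
    finally show ?thesis .
  qed
  have "card {T \<in> copies n H. card (edges S \<inter> edges T) = l}
      \<le> card (\<Union>F\<in>?Fs. {T \<in> copies n H. F \<subseteq> edges T})"
  proof (rule card_mono)
    show "finite (\<Union>F\<in>?Fs. {T \<in> copies n H. F \<subseteq> edges T})" using finF fin by auto
    show "{T \<in> copies n H. card (edges S \<inter> edges T) = l}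
        \<subseteq> (\<Union>F\<in>?Fs. {T \<in> copies n H. F \<subseteq> edges T})"
    proof
      fix T assume "T \<in> {T \<in> copies n H. card (edges S \<inter> edges T) = l}"
      then show "T \<in> (\<Union>F\<in>?Fs. {T \<in> copies n H. F \<subseteq> edges T})"
        by (intro UN_I[of "edges S \<inter> edges T"]) auto
    qed
  qed
  also have "\<dots> \<le> (\<Sum>F\<in>?Fs. card {T \<in> copies n H. F \<subseteq> edges T})"
    by (rule card_UN_le[OF finF])
  finally have "real (card {T \<in> copies n H. card (edges S \<inter> edges T) = l})
      \<le> (\<Sum>F\<in>?Fs. real (card {T \<in> copies n H. F \<subseteq> edges T}))"
    by (simp only: of_nat_sum[symmetric] of_nat_le_iff)
  then have "real (card {T \<in> copies n H. card (edges S \<inter> edges T) = l}) * B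
      \<le> (\<Sum>F\<in>?Fs. real (card {T \<in> copies n H. F \<subseteq> edges T})) * B"
    using B(1) by (rule mult_right_mono)
  also have "\<dots> \<le> (\<Sum>F\<in>?Fs. ?M * real (?k choose l))"
    unfolding sum_distrib_right by (intro sum_mono one)
  also have "\<dots> = real (?k choose l) * (?M * real (?k choose l))"
    using n_subsets[OF fS] card_copy(1)[OF H(1) S] by simp
  also have "\<dots> \<le> 2 ^ ?k * (?M * 2 ^ ?k)"
    using binomial_le_pow2[of ?k l]
    by (intro mult_mono) (auto simp: numeral_power_le_of_nat_cancel_iff intro!: of_nat_le_numeral_power_cancel_iff[THEN iffD2])
  also have "\<dots> = ?M * 4 ^ ?k"
    by (simp add: power_mult_distrib[symmetric])
  finally show ?thesis .
qed

lemma binomial_ratio_le: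
  assumes "m \<le> v" "v \<le> n"
  shows "real (v choose m) * real n ^ m \<le> real (n choose m) * real v ^ m"
proof -
  have eq: "real (a choose m) * real b ^ m = (\<Prod>i=0..<m. real (a - i) / real (m - i) * real b)"
    if "m \<le> a" for a b
    using that by (simp add: binomial_altdef_of_nat prod.distrib del: of_nat_diff times_divide_eq_left)
  have "(\<Prod>i=0..<m. real (v - i) / real (m - i) * real n)
      \<le> (\<Prod>i=0..<m. real (n - i) / real (m - i) * real v)"
  proof (rule prod_mono, intro conjI)
    fix i assume i: "i \<in> {0..<m}"
    have "real i * real v \<le> real i * real n" using assms by (intro mult_left_mono) auto
    then have "real (v - i) * real n \<le> real (n - i) * real v"
      using i assms by (simp add: algebra_simps of_nat_diff)
    then show "real (v - i) / real (m - i) * real n \<le> real (n - i) / real (m - i) * real v"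
      by (simp add: divide_right_mono)
  qed simp
  then show ?thesis using assms by (simp only: eq le_trans)
qed

lemma binomial_le_power: "real (v choose m) \<le> real v ^ m"
proof (cases "m \<le> v")
  case True
  then show ?thesis using binomial_le_pow by (metis of_nat_le_iff of_nat_power)
qed (simp add: binomial_eq_0)

text \<open>A union bound over \<open>m\<close> of the common vertices instead of the common edges, which avoids the exponential
factor in the number of edges: two copies sharing \<open>l\<close> edges share at least \<open>m\<close> vertices.\<close>

lemma overlap_count_vertices:
  assumes H: "simple_graph H" "num_verts H \<le> n" and S: "S \<in> copies n H"
    and m: "\<And>F. F \<subseteq> edges H \<Longrightarrow> card F = l \<Longrightarrow> m \<le> card (\<Union>F)"
    and mv: "m \<le> num_verts H"
  shows "real (card {T \<in> copies n H. card (edges S \<inter> edges T) = l}) * real n ^ m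
    \<le> real (card (copies n H)) * real (num_verts H) ^ (2 * m)"
proof -
  let ?v = "num_verts H" let ?M = "real (card (copies n H))"
  let ?Ds = "{D. D \<subseteq> verts S \<and> card D = m}"
  have fS: "finite (verts S)" using copy_simple[OF S] by (simp add: simple_graph_def)
  have fin: "finite (copies n H)" using copies_finite_nonempty H by auto
  have finD: "finite ?Ds" by (rule finite_subset[of _ "Pow (verts S)"]) (use fS in auto)
  have pos: "0 < real (n choose m)" using mv H(2) by (simp add: zero_less_binomial_iff)
  have one: "real (card {T \<in> copies n H. D \<subseteq> verts T}) * real n ^ m \<le> ?M * real ?v ^ m"
    if D: "D \<in> ?Ds" for D
  proof -
    have "real (card {T \<in> copies n H. D \<subseteq> verts T}) * real (n choose m) \<le> ?M * real (?v choose m)"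
      using copies_through_vertices[OF H, of D m] copy_verts_subset[OF S] D
      by (simp only: of_nat_mult[symmetric] of_nat_le_iff) auto
    then have "real (card {T \<in> copies n H. D \<subseteq> verts T}) * real (n choose m) * real n ^ m
        \<le> ?M * real (?v choose m) * real n ^ m"
      by (rule mult_right_mono) simp
    also have "\<dots> \<le> ?M * (real (n choose m) * real ?v ^ m)"
      using binomial_ratio_le[OF mv H(2)] by (simp add: mult.assoc mult_left_mono)
    finally have "real (n choose m) * (real (card {T \<in> copies n H. D \<subseteq> verts T}) * real n ^ m)
        \<le> real (n choose m) * (?M * real ?v ^ m)"
      by (simp add: mult_ac)
    then show ?thesis using pos by simp
  qed
  have "card {T \<in> copies n H. card (edges S \<inter> edges T) = l}
      \<le> card (\<Union>D\<in>?Ds. {T \<in> copies n H. D \<subseteq> verts T})"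
  proof (rule card_mono)
    show "finite (\<Union>D\<in>?Ds. {T \<in> copies n H. D \<subseteq> verts T})" using finD fin by auto
    show "{T \<in> copies n H. card (edges S \<inter> edges T) = l}
        \<subseteq> (\<Union>D\<in>?Ds. {T \<in> copies n H. D \<subseteq> verts T})"
    proof
      fix T assume T: "T \<in> {T \<in> copies n H. card (edges S \<inter> edges T) = l}"
      let ?F = "edges S \<inter> edges T"
      have "?F \<subseteq> edges S" by simp
      then obtain F0 where "F0 \<subseteq> edges H" "card F0 = card ?F" "card (\<Union>F0) = card (\<Union>?F)"
        "Graph (\<Union>?F) ?F \<in> copies n (Graph (\<Union>F0) F0)"
        by (rule copy_edge_subset[OF H(1) S])
      then have "m \<le> card (\<Union>?F)" using m[of F0] T by auto
      then obtain D where D: "D \<subseteq> \<Union>?F" "card D = m"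
        by (meson obtain_subset_with_card_n)
      have "\<Union>?F \<subseteq> verts S" using simple_graph_edgeD(1)[OF copy_simple[OF S]] by blast
      moreover have "\<Union>?F \<subseteq> verts T"
        using simple_graph_edgeD(1)[OF copy_simple, of T] T by blast
      ultimately show "T \<in> (\<Union>D\<in>?Ds. {T \<in> copies n H. D \<subseteq> verts T})"
        using D T by (intro UN_I[of D]) auto
    qed
  qed
  also have "\<dots> \<le> (\<Sum>D\<in>?Ds. card {T \<in> copies n H. D \<subseteq> verts T})"
    by (rule card_UN_le[OF finD])
  finally have "real (card {T \<in> copies n H. card (edges S \<inter> edges T) = l})
      \<le> (\<Sum>D\<in>?Ds. real (card {T \<in> copies n H. D \<subseteq> verts T}))"
    by (simp only: of_nat_sum[symmetric] of_nat_le_iff)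
  then have "real (card {T \<in> copies n H. card (edges S \<inter> edges T) = l}) * real n ^ m
      \<le> (\<Sum>D\<in>?Ds. real (card {T \<in> copies n H. D \<subseteq> verts T})) * real n ^ m"
    by (rule mult_right_mono) simp
  also have "\<dots> \<le> (\<Sum>D\<in>?Ds. ?M * real ?v ^ m)"
    unfolding sum_distrib_right by (intro sum_mono one)
  also have "\<dots> = real (?v choose m) * (?M * real ?v ^ m)"
    using n_subsets[OF fS] card_copy(2)[OF H(1) S] by simp
  also have "\<dots> \<le> real ?v ^ m * (?M * real ?v ^ m)"
    using binomial_le_power by (intro mult_right_mono) auto
  also have "\<dots> = ?M * real ?v ^ (2 * m)" by (simp add: mult_2 power_add)
  finally show ?thesis .
qed

section \<open>The posterior overlap\<close>

text \<open>The estimation problem only sees the edge sets of the copies, so it is treated for an arbitrary family of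
\<open>k\<close>-element subsets of a finite ground set.\<close>

locale planted_family =
  fixes E :: "'e set" and F :: "'e set set" and k :: nat and p :: real
  assumes finite_ground: "finite E"
    and members: "\<And>h. h \<in> F \<Longrightarrow> h \<subseteq> E \<and> card h = k"
    and nonempty: "F \<noteq> {}"
    and prob: "0 \<le> p" "p \<le> 1"
begin

definition inside :: "'e set \<Rightarrow> 'e set set" where
  "inside y = {h \<in> F. h \<subseteq> y}"

text \<open>The conditional probability of observing \<open>y\<close> given a planted set inside \<open>y\<close>. It does not depend on
that set, which is why the posterior is uniform.\<close>

definition weight :: "'e set \<Rightarrow> real" where
  "weight y = p ^ (card y - k) * (1 - p) ^ (card E - card y)"

text \<open>The expected value of \<open>k - |h \<inter> h'|\<close> for the planted set \<open>h\<close> and an independent posterior sample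
\<open>h'\<close>. Observations that contain no member contribute 0.\<close>

definition mmse :: real where
  "mmse = (\<Sum>y\<in>Pow E. weight y / card F *
     ((\<Sum>h\<in>inside y. \<Sum>h'\<in>inside y. real k - card (h \<inter> h')) / card (inside y)))"

lemma finite_family: "finite F"
  by (rule finite_subset[of _ "Pow E"]) (use members finite_ground in auto)

lemma card_family_pos: "0 < card F"
  using finite_family nonempty by (simp add: card_gt_0_iff)

lemma finite_member: "h \<in> F \<Longrightarrow> finite h"
  using members finite_ground finite_subset by blast

lemma finite_inside: "finite (inside y)"
  using finite_family by (simp add: inside_def)

lemma weight_nonneg: "0 \<le> weight y"
  using prob by (simp add: weight_def)

lemma sum_random_subset:
  assumes "finite B"
  shows "(\<Sum>X\<in>Pow B. p ^ card X * (1 - p) ^ (card B - card X)) = 1"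
proof -
  have "(\<Sum>X\<in>Pow B. p ^ card X * (1 - p) ^ (card B - card X))
      = (\<Sum>X\<in>Pow B. (\<Prod>x\<in>X. p) * (\<Prod>x\<in>B - X. 1 - p))"
    using assms by (intro sum.cong refl) (auto simp: card_Diff_subset finite_subset)
  also have "\<dots> = (\<Prod>x\<in>B. p + (1 - p))" by (rule prod_add[OF assms, symmetric])
  finally show ?thesis by simp
qed

lemma sum_weight_superset:
  assumes "A \<subseteq> E" "k \<le> card A"
  shows "(\<Sum>y\<in>{y. A \<subseteq> y \<and> y \<subseteq> E}. weight y) = p ^ (card A - k)"
proof -
  have fA: "finite A" using assms finite_ground finite_subset by blast
  have "(\<Sum>y\<in>{y. A \<subseteq> y \<and> y \<subseteq> E}. weight y) = (\<Sum>X\<in>Pow (E - A). weight (A \<union> X))"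
    by (rule sum.reindex_bij_witness[of _ "\<lambda>X. A \<union> X" "\<lambda>y. y - A"])
      (use assms in \<open>auto simp: Un_absorb1\<close>)
  also have "\<dots> = (\<Sum>X\<in>Pow (E - A). p ^ (card A - k) *
      (p ^ card X * (1 - p) ^ (card (E - A) - card X)))"
  proof (intro sum.cong refl)
    fix X assume X: "X \<in> Pow (E - A)"
    then have "finite X" using finite_ground finite_subset by blast
    then have c: "card (A \<union> X) = card A + card X"
      using X fA by (intro card_Un_disjoint) auto
    have "card (E - A) = card E - card A"
      using assms(1) fA by (simp add: card_Diff_subset)
    then have "weight (A \<union> X) = p ^ ((card A - k) + card X) * (1 - p) ^ (card (E - A) - card X)"
      using assms(2) by (simp add: weight_def c)
    then show "weight (A \<union> X) = p ^ (card A - k) *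
        (p ^ card X * (1 - p) ^ (card (E - A) - card X))"
      by (simp add: power_add)
  qed
  also have "\<dots> = p ^ (card A - k)"
    using sum_random_subset[of "E - A"] finite_ground
    by (simp add: sum_distrib_left[symmetric])
  finally show ?thesis .
qed

text \<open>Exchanging the sum over observations with a sum over configurations turns an expected number of configurations
inside the observation into a sum of the probabilities \<open>p ^ (card (A x) - k)\<close>.\<close>

lemma sum_weight_swap:
  assumes "finite X" "\<And>x. x \<in> X \<Longrightarrow> A x \<subseteq> E \<and> k \<le> card (A x)"
  shows "(\<Sum>y\<in>Pow E. weight y * (\<Sum>x\<in>X. if A x \<subseteq> y then c x else 0))
    = (\<Sum>x\<in>X. c x * p ^ (card (A x) - k))"
proof -
  have "(\<Sum>y\<in>Pow E. weight y * (\<Sum>x\<in>X. if A x \<subseteq> y then c x else 0))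
      = (\<Sum>y\<in>Pow E. \<Sum>x\<in>X. if A x \<subseteq> y then c x * weight y else 0)"
    by (intro sum.cong refl) (simp add: sum_distrib_left if_distrib mult.commute cong: if_cong)
  also have "\<dots> = (\<Sum>x\<in>X. \<Sum>y\<in>Pow E. if A x \<subseteq> y then c x * weight y else 0)"
    by (rule sum.swap)
  also have "\<dots> = (\<Sum>x\<in>X. c x * p ^ (card (A x) - k))"
  proof (intro sum.cong refl)
    fix x assume x: "x \<in> X"
    have "(\<Sum>y\<in>Pow E. if A x \<subseteq> y then c x * weight y else 0)
        = (\<Sum>y\<in>{y \<in> Pow E. A x \<subseteq> y}. c x * weight y)"
      using finite_ground by (intro sum.inter_filter[symmetric]) simp
    also have "{y \<in> Pow E. A x \<subseteq> y} = {y. A x \<subseteq> y \<and> y \<subseteq> E}" by auto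
    finally show "(\<Sum>y\<in>Pow E. if A x \<subseteq> y then c x * weight y else 0)
        = c x * p ^ (card (A x) - k)"
      using sum_weight_superset[of "A x"] assms(2)[OF x] by (simp add: sum_distrib_left[symmetric])
  qed
  finally show ?thesis .
qed

lemma sum_inside: "(\<Sum>h\<in>inside y. f h) = (\<Sum>h\<in>F. if h \<subseteq> y then f h else (0::real))"
  unfolding inside_def by (rule sum.inter_filter[OF finite_family])

lemma sum_inside_pairs:
  "(\<Sum>h\<in>inside y. \<Sum>h'\<in>inside y. f h h')
    = (\<Sum>z\<in>F \<times> F. if fst z \<union> snd z \<subseteq> y then f (fst z) (snd z) else (0::real))"
proof -
  have "(\<Sum>h\<in>inside y. \<Sum>h'\<in>inside y. f h h')
      = (\<Sum>h\<in>F. \<Sum>h'\<in>F. if h \<union> h' \<subseteq> y then f h h' else 0)"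
    unfolding sum_inside by (intro sum.cong refl) auto
  then show ?thesis by (simp add: sum.cartesian_product case_prod_beta)
qed

lemma sum_weight_inside: "(\<Sum>y\<in>Pow E. weight y * card (inside y)) = card F"
proof -
  have "(\<Sum>y\<in>Pow E. weight y * card (inside y))
      = (\<Sum>y\<in>Pow E. weight y * (\<Sum>h\<in>F. if h \<subseteq> y then 1 else (0::real)))"
    by (simp add: sum_inside[of "\<lambda>_. 1", symmetric])
  also have "\<dots> = (\<Sum>h\<in>F. 1 * p ^ (card h - k))"
    by (rule sum_weight_swap[OF finite_family]) (simp add: members)
  also have "\<dots> = card F" by (simp add: members)
  finally show ?thesis .
qed

lemma card_union_members:
  assumes "h \<in> F" "h' \<in> F"
  shows "card (h \<union> h') - k = k - card (h \<inter> h')" "k \<le> card (h \<union> h')" "card (h \<inter> h') \<le> k"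
  using card_Un_Int[OF finite_member finite_member, OF assms] members[OF assms(1)]
    members[OF assms(2)] card_mono[OF finite_member[OF assms(1)], of "h \<inter> h'"]
    card_mono[of "h \<union> h'" h] finite_member assms by auto

text \<open>Each \<open>h'\<close> inside \<open>y\<close> contains some \<open>j \<in> J\<close>. If \<open>h'\<close> meets \<open>h\<close> in fewer than
\<open>d k\<close> elements, so does \<open>j\<close>; hence the event of small overlap is controlled by the expected number of such
\<open>j\<close> inside the observation.\<close>

lemma mmse_le:
  fixes d :: real
  assumes "finite J" "0 \<le> d" "d \<le> 1"
    and J: "\<And>j. j \<in> J \<Longrightarrow> j \<subseteq> E" "\<And>h. h \<in> F \<Longrightarrow> \<exists>j\<in>J. j \<subseteq> h"
  shows "mmse \<le> (1 - d) * k +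
    k / card F * (\<Sum>h\<in>F. \<Sum>j\<in>{j \<in> J. card (j \<inter> h) < d * k}. p ^ card (j - h))"
proof -
  define c where "c h = {j \<in> J. card (j \<inter> h) < d * k}" for h
  define b where "b y h = (1 - d) * k + k * (\<Sum>j\<in>c h. if j \<subseteq> y then 1 else (0::real))" for y h
  have fc: "finite (c h)" for h using assms(1) by (simp add: c_def)
  have pt: "real k - card (h \<inter> h') \<le> b y h" if h: "h \<in> inside y" "h' \<in> inside y" for y h h'
  proof (cases "card (h \<inter> h') < d * k")
    case False
    have "0 \<le> (\<Sum>j\<in>c h. if j \<subseteq> y then 1 else (0::real))" by (intro sum_nonneg) auto
    then have "0 \<le> k * (\<Sum>j\<in>c h. if j \<subseteq> y then 1 else (0::real))" by simp
    then show ?thesis using False by (simp add: b_def algebra_simps)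
  next
    case True
    have h': "h' \<in> F" "h' \<subseteq> y" using h by (auto simp: inside_def)
    obtain j where j: "j \<in> J" "j \<subseteq> h'" using J(2)[OF h'(1)] by blast
    have "card (j \<inter> h) \<le> card (h \<inter> h')"
      by (rule card_mono) (use j(2) finite_member[OF h'(1)] in auto)
    then have jc: "j \<in> c h" using True j(1) by (simp add: c_def)
    have "(if j \<subseteq> y then 1 else (0::real)) \<le> (\<Sum>j\<in>c h. if j \<subseteq> y then 1 else (0::real))"
      by (rule member_le_sum[OF jc]) (use fc in auto)
    moreover have "j \<subseteq> y" using j h' by auto
    ultimately have "real k * 1 \<le> k * (\<Sum>j\<in>c h. if j \<subseteq> y then 1 else (0::real))"
      by (intro mult_left_mono) auto
    moreover have "0 \<le> (1 - d) * k" using assms(3) by simp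
    ultimately show ?thesis unfolding b_def by linarith
  qed
  have avg: "(\<Sum>h\<in>inside y. \<Sum>h'\<in>inside y. real k - card (h \<inter> h')) / card (inside y)
      \<le> (\<Sum>h\<in>inside y. b y h)" for y
  proof -
    have "(\<Sum>h\<in>inside y. \<Sum>h'\<in>inside y. real k - card (h \<inter> h'))
        \<le> (\<Sum>h\<in>inside y. \<Sum>h'\<in>inside y. b y h)"
      by (intro sum_mono pt)
    also have "\<dots> = (\<Sum>h\<in>inside y. b y h) * card (inside y)"
      by (simp add: sum_distrib_left mult.commute)
    finally show ?thesis
      by (cases "inside y = {}") (simp_all add: divide_le_eq card_gt_0_iff finite_inside)
  qed
  have "mmse \<le> (\<Sum>y\<in>Pow E. weight y / card F * (\<Sum>h\<in>inside y. b y h))"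
    unfolding mmse_def by (intro sum_mono mult_left_mono avg) (simp add: weight_nonneg)
  also have "\<dots> = (\<Sum>y\<in>Pow E. (1 - d) * k / card F * (weight y * card (inside y)) +
      k / card F * (weight y * (\<Sum>z\<in>Sigma F c. if fst z \<union> snd z \<subseteq> y then 1 else (0::real))))"
  proof (intro sum.cong refl)
    fix y
    have "(\<Sum>h\<in>inside y. \<Sum>j\<in>c h. if j \<subseteq> y then 1 else (0::real))
        = (\<Sum>h\<in>F. \<Sum>j\<in>c h. if h \<union> j \<subseteq> y then 1 else (0::real))"
      unfolding sum_inside by (intro sum.cong refl) auto
    also have "\<dots> = (\<Sum>z\<in>Sigma F c. if fst z \<union> snd z \<subseteq> y then 1 else (0::real))"
      using finite_family fc by (simp add: sum.Sigma case_prod_beta)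
    finally have sb: "(\<Sum>h\<in>inside y. b y h) = (1 - d) * k * card (inside y) +
        k * (\<Sum>z\<in>Sigma F c. if fst z \<union> snd z \<subseteq> y then 1 else (0::real))"
      by (simp add: b_def sum.distrib sum_distrib_left[symmetric])
    show "weight y / card F * (\<Sum>h\<in>inside y. b y h)
        = (1 - d) * k / card F * (weight y * card (inside y)) +
          k / card F * (weight y * (\<Sum>z\<in>Sigma F c. if fst z \<union> snd z \<subseteq> y then 1 else (0::real)))"
      unfolding sb by (simp add: ring_distribs add_divide_distrib diff_divide_distrib mult_ac)
  qed
  also have "\<dots> = (1 - d) * k / card F * card F + k / card F *
      (\<Sum>z\<in>Sigma F c. 1 * p ^ (card (fst z \<union> snd z) - k))"
  proof -
    have "(\<Sum>y\<in>Pow E. weight y * (\<Sum>z\<in>Sigma F c. if fst z \<union> snd z \<subseteq> y then 1 else (0::real)))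
        = (\<Sum>z\<in>Sigma F c. 1 * p ^ (card (fst z \<union> snd z) - k))"
    proof (rule sum_weight_swap)
      show "finite (Sigma F c)" using finite_family fc by auto
      show "fst z \<union> snd z \<subseteq> E \<and> k \<le> card (fst z \<union> snd z)" if z: "z \<in> Sigma F c" for z
      proof -
        have "fst z \<in> F" "snd z \<in> J" using z by (auto simp: c_def)
        then have sub: "fst z \<union> snd z \<subseteq> E" and m: "card (fst z) = k"
          using J(1) members by blast+
        have "card (fst z) \<le> card (fst z \<union> snd z)"
          by (rule card_mono) (use sub finite_ground finite_subset in auto)
        then show ?thesis using sub m by simp
      qed
    qed
    then show ?thesis
      by (simp only: sum.distrib sum_distrib_left[symmetric] sum_weight_inside)
  qed
  also have "(\<Sum>z\<in>Sigma F c. 1 * p ^ (card (fst z \<union> snd z) - k))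
      = (\<Sum>h\<in>F. \<Sum>j\<in>c h. p ^ card (j - h))"
  proof -
    have "card (h \<union> j) - k = card (j - h)" if "h \<in> F" "j \<in> c h" for h j
    proof -
      have "j \<subseteq> E" using that J(1) by (simp add: c_def)
      then have "finite j" using finite_ground finite_subset by blast
      then have "card (h \<union> (j - h)) = card h + card (j - h)"
        using finite_member[OF that(1)] by (intro card_Un_disjoint) auto
      then show ?thesis using members[OF that(1)] by simp
    qed
    then have "(\<Sum>h\<in>F. \<Sum>j\<in>c h. p ^ card (j - h)) = (\<Sum>h\<in>F. \<Sum>j\<in>c h. p ^ (card (h \<union> j) - k))"
      by (intro sum.cong refl) simp
    then show ?thesis using finite_family fc by (simp add: sum.Sigma case_prod_beta)
  qed
  finally show ?thesis using card_family_pos by (simp add: c_def)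
qed

text \<open>The posterior probability of a large overlap is a ratio of a number of pairs to the number \<open>Z\<close> of
members inside \<open>y\<close>. Observations with \<open>Z \<le> t M p^k\<close> have planted probability at most \<open>t\<close>, because the
planted law has density \<open>Z / (M p^k)\<close> with respect to the law of a random subset. For all others the denominator is
replaced by \<open>t M p^k\<close>, which leaves an expected number of pairs.\<close>

lemma mmse_ge:
  fixes t q :: real
  assumes "0 < p" "0 < t" "0 \<le> q"
  shows "real k - mmse \<le> q * k + k * (t + (1 / t) *
    ((\<Sum>h\<in>F. \<Sum>h'\<in>{h' \<in> F. q * k \<le> card (h \<inter> h')}. (1 / p) ^ card (h \<inter> h')) / (card F)\<^sup>2))"
proof -
  let ?M = "real (card F)" let ?Z = "\<lambda>y. real (card (inside y))"
  define W where "W y = (\<Sum>h\<in>inside y. \<Sum>h'\<in>inside y. if q * k \<le> card (h \<inter> h') then 1 else (0::real))" for y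
  define f where "f z = (if q * k \<le> card (fst z \<inter> snd z) then 1 else (0::real))" for z :: "'e set \<times> 'e set"
  have M: "0 < ?M" using card_family_pos by simp
  have W0: "0 \<le> W y" for y unfolding W_def by (intro sum_nonneg) auto
  have W2: "W y \<le> ?Z y * ?Z y" for y
  proof -
    have "W y \<le> (\<Sum>h\<in>inside y. \<Sum>h'\<in>inside y. 1)" unfolding W_def by (intro sum_mono) auto
    then show ?thesis by simp
  qed
  have pw: "weight y / ?M * ?Z y * k - weight y / ?M *
      ((\<Sum>h\<in>inside y. \<Sum>h'\<in>inside y. real k - card (h \<inter> h')) / ?Z y)
      \<le> q * k / ?M * (weight y * ?Z y) + k * (t * (weight y * p ^ k)) +
        k / (t * ?M\<^sup>2 * p ^ k) * (weight y * W y)" for y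
  proof (cases "inside y = {}")
    case True
    then show ?thesis using assms weight_nonneg[of y] by (simp add: W_def)
  next
    case False
    then have Z: "0 < ?Z y" by (simp add: card_gt_0_iff finite_inside)
    have "?Z y * k - (\<Sum>h\<in>inside y. \<Sum>h'\<in>inside y. real k - card (h \<inter> h')) / ?Z y
        = (\<Sum>h\<in>inside y. \<Sum>h'\<in>inside y. real (card (h \<inter> h'))) / ?Z y"
      using Z by (simp add: sum_subtractf field_simps)
    also have "\<dots> \<le> (\<Sum>h\<in>inside y. \<Sum>h'\<in>inside y. q * k + k * (if q * k \<le> card (h \<inter> h') then 1 else (0::real))) / ?Z y"
    proof (intro divide_right_mono sum_mono)
      fix h h' assume "h \<in> inside y" "h' \<in> inside y"
      then have "card (h \<inter> h') \<le> k" using card_union_members(3) by (auto simp: inside_def)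
      then show "real (card (h \<inter> h')) \<le> q * k + k * (if q * k \<le> card (h \<inter> h') then 1 else (0::real))"
        using assms(3) by (auto simp: add_increasing)
    qed simp
    also have "\<dots> = q * k * ?Z y + k * (W y / ?Z y)"
      using Z by (simp add: sum.distrib W_def sum_distrib_left[symmetric] field_simps)
    also have "W y / ?Z y \<le> t * ?M * p ^ k + W y / (t * ?M * p ^ k)"
    \<comment> \<open>Few members: bound the ratio by \<open>Z\<close>, the density. Many members: bound the denominator.\<close>
    proof (cases "?Z y \<le> t * ?M * p ^ k")
      case True
      have "W y / ?Z y \<le> ?Z y" using W2[of y] Z by (simp add: divide_le_eq)
      moreover have "0 \<le> W y / (t * ?M * p ^ k)" using W0 assms M by simp
      ultimately show ?thesis using True by linarith
    next
      case False
      then have "W y / ?Z y \<le> W y / (t * ?M * p ^ k)"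
        using W0[of y] assms M Z by (intro divide_left_mono) auto
      moreover have "0 \<le> t * ?M * p ^ k" using assms M by simp
      ultimately show ?thesis by linarith
    qed
    finally have b: "?Z y * k - (\<Sum>h\<in>inside y. \<Sum>h'\<in>inside y. real k - card (h \<inter> h')) / ?Z y
        \<le> q * k * ?Z y + k * (t * ?M * p ^ k + W y / (t * ?M * p ^ k))"
      by (simp add: mult_left_mono)
    have "weight y / ?M * (?Z y * k - (\<Sum>h\<in>inside y. \<Sum>h'\<in>inside y. real k - card (h \<inter> h')) / ?Z y)
        \<le> weight y / ?M * (q * k * ?Z y + k * (t * ?M * p ^ k + W y / (t * ?M * p ^ k)))"
      by (rule mult_left_mono[OF b]) (simp add: weight_nonneg)
    also have "\<dots> = q * k / ?M * (weight y * ?Z y) + k * (t * (weight y * p ^ k)) +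
        k / (t * ?M\<^sup>2 * p ^ k) * (weight y * W y)"
      using M assms by (simp add: field_simps power2_eq_square)
    finally show ?thesis by (simp add: right_diff_distrib mult.assoc)
  qed
  have "real k = (\<Sum>y\<in>Pow E. weight y / ?M * ?Z y * k)"
  proof -
    have "(\<Sum>y\<in>Pow E. weight y / ?M * ?Z y * k) = k / ?M * (\<Sum>y\<in>Pow E. weight y * ?Z y)"
      by (simp add: sum_distrib_left mult_ac)
    then show ?thesis using M by (simp add: sum_weight_inside)
  qed
  then have "real k - mmse = (\<Sum>y\<in>Pow E. weight y / ?M * ?Z y * k - weight y / ?M *
      ((\<Sum>h\<in>inside y. \<Sum>h'\<in>inside y. real k - card (h \<inter> h')) / ?Z y))"
    unfolding mmse_def sum_subtractf by simp
  also have "\<dots> \<le> (\<Sum>y\<in>Pow E. q * k / ?M * (weight y * ?Z y) + k * (t * (weight y * p ^ k)) +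
        k / (t * ?M\<^sup>2 * p ^ k) * (weight y * W y))"
    by (intro sum_mono pw)
  also have "\<dots> = q * k / ?M * (\<Sum>y\<in>Pow E. weight y * ?Z y) + k * (t * (\<Sum>y\<in>Pow E. weight y * p ^ k)) +
        k / (t * ?M\<^sup>2 * p ^ k) * (\<Sum>y\<in>Pow E. weight y * W y)"
    by (simp only: sum.distrib sum_distrib_left)
  also have "(\<Sum>y\<in>Pow E. weight y * ?Z y) = ?M" by (rule sum_weight_inside)
  also have "(\<Sum>y\<in>Pow E. weight y * W y) = (\<Sum>z\<in>F \<times> F. f z * p ^ (card (fst z \<union> snd z) - k))"
    unfolding W_def sum_inside_pairs f_def
  proof (rule sum_weight_swap)
    show "finite (F \<times> F)" using finite_family by simp
    show "fst z \<union> snd z \<subseteq> E \<and> k \<le> card (fst z \<union> snd z)" if "z \<in> F \<times> F" for z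
      using that members[of "fst z"] members[of "snd z"] card_union_members(2)[of "fst z" "snd z"]
      by (auto simp: mem_Times_iff)
  qed
  also have "\<dots> = p ^ k * (\<Sum>z\<in>F \<times> F. f z * (1 / p) ^ card (fst z \<inter> snd z))"
    unfolding sum_distrib_left
  proof (intro sum.cong refl)
    fix z assume z: "z \<in> F \<times> F"
    then have u: "card (fst z \<union> snd z) - k = k - card (fst z \<inter> snd z)" "card (fst z \<inter> snd z) \<le> k"
      using card_union_members[of "fst z" "snd z"] by auto
    have "p ^ k * (1 / p) ^ card (fst z \<inter> snd z) = p ^ (k - card (fst z \<inter> snd z))"
      using u(2) assms(1) by (simp add: power_diff power_one_over field_simps)
    then show "f z * p ^ (card (fst z \<union> snd z) - k) = p ^ k * (f z * (1 / p) ^ card (fst z \<inter> snd z))"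
      unfolding u(1) by (simp add: mult_ac)
  qed
  also have "(\<Sum>z\<in>F \<times> F. f z * (1 / p) ^ card (fst z \<inter> snd z))
      = (\<Sum>h\<in>F. \<Sum>h'\<in>{h' \<in> F. q * k \<le> card (h \<inter> h')}. (1 / p) ^ card (h \<inter> h'))"
  proof -
    have "(\<Sum>h'\<in>F. f (h, h') * (1 / p) ^ card (h \<inter> h'))
        = (\<Sum>h'\<in>{h' \<in> F. q * k \<le> card (h \<inter> h')}. (1 / p) ^ card (h \<inter> h'))" for h
      by (subst sum.inter_filter[OF finite_family]) (auto simp: f_def intro!: sum.cong)
    then show ?thesis by (simp add: sum.cartesian_product' case_prod_beta)
  qed
  finally have fin: "real k - mmse \<le> q * k / ?M * ?M + k * (t * (\<Sum>y\<in>Pow E. weight y * p ^ k)) +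
      k / (t * ?M\<^sup>2 * p ^ k) * (p ^ k *
      (\<Sum>h\<in>F. \<Sum>h'\<in>{h' \<in> F. q * k \<le> card (h \<inter> h')}. (1 / p) ^ card (h \<inter> h')))" .
  have "(\<Sum>y\<in>Pow E. weight y * p ^ k) \<le> 1"
  proof -
    have "weight y * p ^ k \<le> p ^ card y * (1 - p) ^ (card E - card y)" for y
    proof -
      have "p ^ (card y - k) * p ^ k \<le> p ^ card y"
        unfolding power_add[symmetric] using prob by (intro power_decreasing) auto
      then have "p ^ (card y - k) * p ^ k * (1 - p) ^ (card E - card y)
          \<le> p ^ card y * (1 - p) ^ (card E - card y)"
        using prob by (intro mult_right_mono) auto
      then show ?thesis by (simp add: weight_def mult_ac)
    qed
    then have "(\<Sum>y\<in>Pow E. weight y * p ^ k) \<le> (\<Sum>y\<in>Pow E. p ^ card y * (1 - p) ^ (card E - card y))"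
      by (intro sum_mono)
    then show ?thesis using sum_random_subset[OF finite_ground] by simp
  qed
  then have "k * (t * (\<Sum>y\<in>Pow E. weight y * p ^ k)) \<le> k * (t * 1)"
    using assms(2) by (intro mult_left_mono) auto
  then show ?thesis using fin M assms(1) by (simp add: algebra_simps)
qed

end

text \<open>The total variance of the indicators around their mean, in terms of the pairwise intersections: the sum over \<open>e\<close>
of the squared degrees counts pairs with multiplicity \<open>card (h \<inter> h')\<close>.\<close>

lemma sum_square_deviation:
  fixes A :: "'e set set"
  assumes "finite E" "finite A" "A \<noteq> {}" "\<And>h. h \<in> A \<Longrightarrow> h \<subseteq> E \<and> card h = k"
  shows "(\<Sum>h\<in>A. \<Sum>e\<in>E. (indicator h e - real (card {h \<in> A. e \<in> h}) / card A)\<^sup>2)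
    = (\<Sum>h\<in>A. \<Sum>h'\<in>A. real k - card (h \<inter> h')) / card A"
proof -
  let ?Z = "real (card A)" let ?d = "\<lambda>e. real (card {h \<in> A. e \<in> h})"
  have Z: "0 < ?Z" using assms by (simp add: card_gt_0_iff)
  have d: "?d e = (\<Sum>h\<in>A. indicator h e)" for e
    using assms(2) by (simp add: indicator_def sum.If_cases Int_def)
  have hh: "real (card (h \<inter> h')) = (\<Sum>e\<in>E. indicator h e * indicator h' e)" if "h \<in> A" for h h'
  proof -
    have "E \<inter> h \<inter> h' = h \<inter> h'" using assms(4)[OF that] by auto
    then show ?thesis
      using assms(1) by (simp add: indicator_inter_arith[symmetric] indicator_def sum.If_cases)
  qed
  have dd: "(\<Sum>h\<in>A. \<Sum>h'\<in>A. real (card (h \<inter> h'))) = (\<Sum>e\<in>E. (?d e)\<^sup>2)"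
  proof -
    have "(\<Sum>h\<in>A. \<Sum>h'\<in>A. real (card (h \<inter> h')))
        = (\<Sum>h\<in>A. \<Sum>h'\<in>A. \<Sum>e\<in>E. indicator h e * indicator h' e)"
      by (intro sum.cong refl hh)
    also have "\<dots> = (\<Sum>h\<in>A. \<Sum>e\<in>E. \<Sum>h'\<in>A. indicator h e * indicator h' e)"
      by (intro sum.cong refl sum.swap)
    also have "\<dots> = (\<Sum>e\<in>E. \<Sum>h\<in>A. \<Sum>h'\<in>A. indicator h e * indicator h' e)"
      by (rule sum.swap)
    finally show ?thesis by (simp add: d power2_eq_square sum_product)
  qed
  have k: "(\<Sum>e\<in>E. indicator h e) = real k" if "h \<in> A" for h
  proof -
    have "(\<Sum>e\<in>E. indicator h e * indicator h e) = (\<Sum>e\<in>E. indicator h e :: real)"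
      by (intro sum.cong refl) (simp add: indicator_def)
    then show ?thesis using hh[OF that, of h] assms(4)[OF that] by (simp only: Int_absorb)
  qed
  have "(\<Sum>h\<in>A. \<Sum>e\<in>E. (indicator h e - ?d e / ?Z)\<^sup>2)
      = (\<Sum>h\<in>A. \<Sum>e\<in>E. indicator h e + (?d e / ?Z)\<^sup>2 - 2 * (?d e / ?Z) * indicator h e)"
    by (intro sum.cong refl) (auto simp: indicator_def power2_eq_square algebra_simps)
  also have "\<dots> = (\<Sum>h\<in>A. real k + (\<Sum>e\<in>E. (?d e / ?Z)\<^sup>2) - (\<Sum>e\<in>E. 2 * (?d e / ?Z) * indicator h e))"
    by (intro sum.cong refl) (simp add: sum.distrib sum_subtractf k)
  also have "\<dots> = ?Z * k + ?Z * (\<Sum>e\<in>E. (?d e / ?Z)\<^sup>2) - (\<Sum>h\<in>A. \<Sum>e\<in>E. 2 * (?d e / ?Z) * indicator h e)"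
    by (simp add: sum.distrib sum_subtractf ring_distribs)
  also have "(\<Sum>h\<in>A. \<Sum>e\<in>E. 2 * (?d e / ?Z) * indicator h e)
      = (\<Sum>e\<in>E. \<Sum>h\<in>A. 2 * (?d e / ?Z) * indicator h e)"
    by (rule sum.swap)
  also have "\<dots> = (\<Sum>e\<in>E. 2 * (?d e / ?Z) * ?d e)"
    by (simp only: d sum_distrib_left)
  also have "?Z * k + ?Z * (\<Sum>e\<in>E. (?d e / ?Z)\<^sup>2) - \<dots> = ?Z * k - (\<Sum>e\<in>E. (?d e)\<^sup>2) / ?Z"
  proof -
    have "?Z * (\<Sum>e\<in>E. (?d e / ?Z)\<^sup>2) = (\<Sum>e\<in>E. (?d e)\<^sup>2) / ?Z"
      using Z by (simp add: power_divide sum_divide_distrib[symmetric] power2_eq_square)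
    moreover have "(\<Sum>e\<in>E. 2 * (?d e / ?Z) * ?d e) = 2 * ((\<Sum>e\<in>E. (?d e)\<^sup>2) / ?Z)"
      by (simp add: power2_eq_square sum_divide_distrib sum_distrib_left mult.assoc)
    ultimately show ?thesis by simp
  qed
  also have "\<dots> = (\<Sum>h\<in>A. \<Sum>h'\<in>A. real k - card (h \<inter> h')) / ?Z"
    using Z by (simp add: sum_subtractf dd field_simps)
  finally show ?thesis .
qed


lemma prob_gnp_union:
  assumes h: "h \<subseteq> edges (complete_graph n)" and p: "0 \<le> p" "p \<le> 1"
  shows "measure_pmf.prob (gnp_pmf n p) {G. h \<union> G = y} =
    (if h \<subseteq> y \<and> y \<subseteq> edges (complete_graph n)
     then p ^ (card y - card h) * (1 - p) ^ (card (edges (complete_graph n)) - card y) else 0)"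
proof -
  let ?E = "edges (complete_graph n)"
  let ?P = "Pi_pmf ?E False (\<lambda>_. bernoulli_pmf p)"
  have fE: "finite ?E" by (simp add: complete_graph_def finite_imp_finite_nsets)
  have eq: "measure_pmf.prob (gnp_pmf n p) {G. h \<union> G = y}
      = measure_pmf.prob ?P {b. h \<union> {e \<in> ?E. b e} = y}"
    by (simp add: gnp_pmf_def vimage_def)
  show ?thesis
  proof (cases "h \<subseteq> y \<and> y \<subseteq> ?E")
    case False
    then have e: "{b. h \<union> {e \<in> ?E. b e} = y} = {}" using h by auto
    show ?thesis using False unfolding eq e by auto
  next
    case True
    have fy: "finite y" "finite h" using finite_subset[OF _ fE] True h by simp_all
    define B where "B e = (if e \<in> h then UNIV else if e \<in> y then {True} else {False})" for e
    have "{b. h \<union> {e \<in> ?E. b e} = y} = Pi ?E B"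
    proof (intro equalityI subsetI)
      fix b assume "b \<in> {b. h \<union> {e \<in> ?E. b e} = y}"
      then have b: "h \<union> {e \<in> ?E. b e} = y" by simp
      have "b e \<in> B e" if e: "e \<in> ?E" for e
      proof -
        have "e \<in> y \<longleftrightarrow> e \<in> h \<or> b e" using b e by blast
        then show ?thesis by (simp add: B_def)
      qed
      then show "b \<in> Pi ?E B" by (rule Pi_I)
    next
      fix b assume b: "b \<in> Pi ?E B"
      have "b e \<longleftrightarrow> e \<in> y" if "e \<in> ?E" "e \<notin> h" for e
        using Pi_mem[OF b that(1)] that(2) by (cases "e \<in> y") (simp_all add: B_def)
      then have "{e \<in> ?E. b e} - h = y - h" using True by (intro set_eqI) auto
      then have "h \<union> {e \<in> ?E. b e} = y" using True by (metis Un_Diff_cancel Un_absorb1)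
      then show "b \<in> {b. h \<union> {e \<in> ?E. b e} = y}" by simp
    qed
    then have "measure_pmf.prob ?P {b. h \<union> {e \<in> ?E. b e} = y}
        = (\<Prod>e\<in>?E. measure_pmf.prob (bernoulli_pmf p) (B e))"
      by (simp add: measure_Pi_pmf_Pi[OF fE])
    also have "\<dots> = (\<Prod>e\<in>?E. if e \<in> y then (if e \<in> h then 1 else p) else 1 - p)"
      using True p by (intro prod.cong refl) (auto simp: B_def measure_pmf_single)
    also have "\<dots> = (\<Prod>e\<in>?E \<inter> y. if e \<in> h then 1 else p) * (\<Prod>e\<in>?E \<inter> - y. 1 - p)"
      by (simp add: prod.If_cases[OF fE])
    also have "?E \<inter> y = y" using True by (intro Int_absorb1) simp
    also have "?E \<inter> - y = ?E - y" by (rule Diff_eq[symmetric])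
    also have "(\<Prod>e\<in>y. if e \<in> h then 1 else p) = p ^ card (y - h)"
      by (simp add: prod.If_cases[OF fy(1)] Diff_eq)
    also have "card (y - h) = card y - card h"
      by (rule card_Diff_subset) (use True fy in auto)
    also have "(\<Prod>e\<in>?E - y. 1 - p) = (1 - p) ^ (card ?E - card y)"
      using True fy by (simp only: prod_constant card_Diff_subset)
    finally show ?thesis unfolding eq by (simp only: True simp_thms if_True)
  qed
qed

context
  fixes H :: "'a graph" and n :: nat and p :: real
  assumes H: "simple_graph H" "no_isolated_vertices H" "num_verts H \<le> n"
    and p: "0 \<le> p" "p \<le> 1"
begin

lemma planted_family_copies:
  "planted_family (edges (complete_graph n)) (edges ` copies n H) (num_edges H) p"
proof
  show "finite (edges (complete_graph n))"
    by (simp add: complete_graph_def finite_imp_finite_nsets)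
  show "edges ` copies n H \<noteq> {}" using copies_finite_nonempty[OF H(1,3)] by simp
  show "h \<subseteq> edges (complete_graph n) \<and> card h = num_edges H" if "h \<in> edges ` copies n H" for h
  proof -
    obtain S where S: "S \<in> copies n H" "h = edges S" using \<open>h \<in> edges ` copies n H\<close> by (rule imageE)
    then show ?thesis using copy_edges_subset[OF S(1)] card_copy(1)[OF H(1) S(1)] by simp
  qed
qed (use p in auto)

interpretation planted_family "edges (complete_graph n)" "edges ` copies n H" "num_edges H" p
  by (rule planted_family_copies)

lemma pmf_planted:
  "pmf (planted_pmf n H p) (h, y) =
    (if h \<in> edges ` copies n H \<and> h \<subseteq> y \<and> y \<subseteq> edges (complete_graph n)
     then weight y / card (edges ` copies n H) else 0)"
proof -
  let ?C = "copies n H"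
  note C = copies_finite_nonempty[OF H(1,3)]
  have "planted_pmf n H p =
      pmf_of_set ?C \<bind> (\<lambda>S. map_pmf (\<lambda>G. (edges S, edges S \<union> G)) (gnp_pmf n p))"
    by (simp add: planted_pmf_def pair_pmf_def map_bind_pmf map_pmf_def bind_assoc_pmf bind_return_pmf)
  then have "pmf (planted_pmf n H p) (h, y) =
      (\<Sum>S\<in>?C. pmf (map_pmf (\<lambda>G. (edges S, edges S \<union> G)) (gnp_pmf n p)) (h, y)) / card ?C"
    by (simp add: pmf_bind integral_pmf_of_set[OF C(2,1)])
  also have "(\<Sum>S\<in>?C. pmf (map_pmf (\<lambda>G. (edges S, edges S \<union> G)) (gnp_pmf n p)) (h, y))
      = (\<Sum>S\<in>?C. if edges S = h then measure_pmf.prob (gnp_pmf n p) {G. h \<union> G = y} else 0)"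
    by (intro sum.cong refl) (auto simp: pmf_map vimage_def)
  also have "\<dots> = (\<Sum>g\<in>edges ` ?C. if g = h then measure_pmf.prob (gnp_pmf n p) {G. h \<union> G = y} else 0)"
    by (simp add: sum.reindex[OF inj_on_edges_copies[OF H(1,2)]])
  also have "\<dots> = (if h \<in> edges ` ?C then measure_pmf.prob (gnp_pmf n p) {G. h \<union> G = y} else 0)"
    using finite_family by simp
  also have "card ?C = card (edges ` ?C)"
    by (simp add: card_image[OF inj_on_edges_copies[OF H(1,2)]])
  finally show ?thesis
    using members[of h] prob_gnp_union[of h n p y] p by (auto simp: weight_def)
qed

text \<open>The weight cancels in the conditional probability, so the posterior is uniform on the members inside \<open>y\<close>.\<close>

lemma posterior_mean_eq:
  assumes y: "y \<subseteq> edges (complete_graph n)" "weight y \<noteq> 0" "inside y \<noteq> {}"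
  shows "posterior_mean n H p y e = real (card {h \<in> inside y. e \<in> h}) / card (inside y)"
proof -
  let ?P = "planted_pmf n H p" and ?s = "{\<omega>. snd \<omega> = y}"
  let ?w = "weight y / card (edges ` copies n H)"
  have w: "?w > 0" using y(2) weight_nonneg[of y] card_family_pos by simp
  have supp: "set_pmf ?P \<inter> ?s = (\<lambda>h. (h, y)) ` inside y"
  proof (intro equalityI subsetI)
    fix z assume z: "z \<in> set_pmf ?P \<inter> ?s"
    then obtain h where h: "z = (h, y)" by (cases z) auto
    then have "pmf ?P (h, y) \<noteq> 0" using z by (simp add: set_pmf_iff)
    then have "h \<in> inside y" unfolding pmf_planted inside_def by (simp split: if_splits)
    then show "z \<in> (\<lambda>h. (h, y)) ` inside y" using h by simp
  next
    fix z assume "z \<in> (\<lambda>h. (h, y)) ` inside y"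
    then obtain h where h: "z = (h, y)" "h \<in> inside y" by auto
    then have "pmf ?P z = ?w" using y(1) unfolding h pmf_planted inside_def by simp
    then have "pmf ?P z \<noteq> 0" using w by linarith
    then show "z \<in> set_pmf ?P \<inter> ?s" using h by (simp add: set_pmf_iff)
  qed
  have "measure_pmf.prob ?P ?s = measure_pmf.prob ?P ((\<lambda>h. (h, y)) ` inside y)"
    using measure_Int_set_pmf[of ?P ?s] by (simp add: supp[symmetric] Int_commute)
  also have "\<dots> = (\<Sum>h\<in>inside y. pmf ?P (h, y))"
    by (simp add: measure_measure_pmf_finite finite_inside sum.reindex inj_on_def)
  also have "\<dots> = (\<Sum>h\<in>inside y. ?w)"
    using y(1) by (intro sum.cong refl) (auto simp: pmf_planted inside_def)
  finally have m: "measure_pmf.prob ?P ?s = card (inside y) * ?w" by simp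
  have ne: "set_pmf ?P \<inter> ?s \<noteq> {}" using y(3) supp by simp
  have "posterior_mean n H p y e = (\<Sum>\<omega>\<in>(\<lambda>h. (h, y)) ` inside y.
      indicator (fst \<omega>) e * pmf (cond_pmf ?P ?s) \<omega>)"
    unfolding posterior_mean_def
    by (rule integral_measure_pmf_real)
      (use finite_inside supp in \<open>auto simp: set_cond_pmf[OF ne]\<close>)
  also have "\<dots> = (\<Sum>h\<in>inside y. indicator h e * (?w / (card (inside y) * ?w)))"
  proof -
    have "pmf (cond_pmf ?P ?s) (h, y) = ?w / (card (inside y) * ?w)" if "h \<in> inside y" for h
    proof -
      have "pmf ?P (h, y) = ?w" using y(1) that unfolding pmf_planted inside_def by simp
      then show ?thesis by (simp only: pmf_cond[OF ne] m mem_Collect_eq snd_conv simp_thms if_True)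
    qed
    then have "(\<Sum>h\<in>inside y. indicator h e * pmf (cond_pmf ?P ?s) (h, y))
        = (\<Sum>h\<in>inside y. indicator h e * (?w / (card (inside y) * ?w)))"
      by (intro sum.cong refl arg_cong2[of _ _ _ _ "(*)"])
    then show ?thesis by (simp add: sum.reindex inj_on_def)
  qed
  also have "\<dots> = (\<Sum>h\<in>inside y. indicator h e) / card (inside y)"
  proof -
    have "?w / (card (inside y) * ?w) = 1 / card (inside y)"
      by (rule nonzero_divide_mult_cancel_right) (use w in linarith)
    then show ?thesis by (simp only: sum_divide_distrib times_divide_eq_right mult_1_right)
  qed
  also have "(\<Sum>h\<in>inside y. indicator h e) = real (card {h \<in> inside y. e \<in> h})"
    using finite_inside by (simp add: indicator_def sum.If_cases Int_def)
  finally show ?thesis .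
qed

lemma MMSE_eq_mmse: "MMSE n H p = mmse"
proof -
  let ?F = "edges ` copies n H" and ?E = "edges (complete_graph n)"
  let ?d = "\<lambda>h y. \<Sum>e\<in>?E. (indicator h e - posterior_mean n H p y e)\<^sup>2"
  have "MMSE n H p = (\<Sum>z\<in>?F \<times> Pow ?E. ?d (fst z) (snd z) * pmf (planted_pmf n H p) z)"
    unfolding MMSE_def case_prod_beta
  proof (rule integral_measure_pmf_real)
    show "finite (?F \<times> Pow ?E)" using finite_family finite_ground by simp
    show "z \<in> ?F \<times> Pow ?E" if "z \<in> set_pmf (planted_pmf n H p)" for z
      using that by (cases z) (auto simp: set_pmf_eq pmf_planted split: if_splits)
  qed
  also have "\<dots> = (\<Sum>h\<in>?F. \<Sum>y\<in>Pow ?E. ?d h y * pmf (planted_pmf n H p) (h, y))"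
    by (simp add: sum.cartesian_product')
  also have "\<dots> = (\<Sum>y\<in>Pow ?E. \<Sum>h\<in>?F. ?d h y * pmf (planted_pmf n H p) (h, y))"
    by (rule sum.swap)
  also have "\<dots> = (\<Sum>y\<in>Pow ?E. weight y / card ?F * (\<Sum>h\<in>inside y. ?d h y))"
    unfolding sum_inside sum_distrib_left
    by (intro sum.cong refl) (auto simp: pmf_planted)
  also have "\<dots> = mmse"
    unfolding mmse_def
  proof (intro sum.cong refl)
    fix y assume y: "y \<in> Pow ?E"
    show "weight y / card ?F * (\<Sum>h\<in>inside y. ?d h y) = weight y / card ?F *
      ((\<Sum>h\<in>inside y. \<Sum>h'\<in>inside y. real (num_edges H) - card (h \<inter> h')) / card (inside y))"
    proof (cases "weight y = 0 \<or> inside y = {}")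
      case False
      have "(\<Sum>h\<in>inside y. ?d h y)
          = (\<Sum>h\<in>inside y. \<Sum>e\<in>?E. (indicator h e - real (card {h \<in> inside y. e \<in> h}) / card (inside y))\<^sup>2)"
        using posterior_mean_eq[of y] y False by simp
      also have "\<dots> = (\<Sum>h\<in>inside y. \<Sum>h'\<in>inside y. real (num_edges H) - card (h \<inter> h')) / card (inside y)"
        using False members
        by (intro sum_square_deviation finite_ground finite_inside) (auto simp: inside_def)
      finally show ?thesis by simp
    qed auto
  qed
  finally show ?thesis .
qed

end

section \<open>Error bounds in terms of first moment thresholds\<close>

lemma p_1M_pos: "simple_graph J \<Longrightarrow> 0 < p_1M n J"
  using copy_count_pos[of J n] by (simp add: p_1M_def)

lemma copy_count_eq_powr:
  assumes "simple_graph J" "1 \<le> num_edges J"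
  shows "copy_count n J = p_1M n J powr (- real (num_edges J))"
  using copy_count_pos[OF assms(1), of n] assms(2) by (simp add: p_1M_def powr_powr)

lemma finite_subgraphs:
  assumes "simple_graph H"
  shows "finite {J. subgraph J H \<and> Q J}"
proof (rule finite_subset)
  show "{J. subgraph J H \<and> Q J} \<subseteq> (\<lambda>(V, F). Graph V F) ` (Pow (verts H) \<times> Pow (edges H))"
  proof
    fix J assume "J \<in> {J. subgraph J H \<and> Q J}"
    then show "J \<in> (\<lambda>(V, F). Graph V F) ` (Pow (verts H) \<times> Pow (edges H))"
      by (intro image_eqI[of _ _ "(verts J, edges J)"]) (auto simp: subgraph_def)
  qed
  show "finite ((\<lambda>(V, F). Graph V F) ` (Pow (verts H) \<times> Pow (edges H)))"
    using assms finite_edges[OF assms] by (simp add: simple_graph_def)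
qed

lemma subgraph_refl: "simple_graph H \<Longrightarrow> subgraph H H"
  by (simp add: subgraph_def)

lemma p_1M_le_psi:
  fixes q :: real
  assumes "simple_graph H" "subgraph J H" "max 1 (q * real (num_edges H)) \<le> num_edges J"
  shows "p_1M n J \<le> psi n q H"
  unfolding psi_def using assms finite_subgraphs[OF assms(1)] by (intro Max_ge) auto

lemma psi_attained:
  fixes q :: real
  assumes "simple_graph H" "1 \<le> num_edges H" "q \<le> 1"
  obtains J where "subgraph J H" "max 1 (q * real (num_edges H)) \<le> num_edges J" "psi n q H = p_1M n J"
proof -
  let ?A = "{J. subgraph J H \<and> real (num_edges J) \<ge> max 1 (q * real (num_edges H))}"
  have "q * real (num_edges H) \<le> 1 * real (num_edges H)"
    using assms by (intro mult_right_mono) auto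
  then have "H \<in> ?A" using assms subgraph_refl by auto
  then have "psi n q H \<in> p_1M n ` ?A"
    unfolding psi_def using finite_subgraphs[OF assms(1)] by (intro Max_in) auto
  then obtain J where "J \<in> ?A" "psi n q H = p_1M n J" by (rule imageE)
  then show thesis by (intro that) auto
qed

text \<open>Without isolated vertices, a subgraph with all edges of \<open>H\<close> is \<open>H\<close> itself.\<close>

lemma psi_one:
  assumes "simple_graph H" "no_isolated_vertices H" "1 \<le> num_edges H"
  shows "psi n 1 H = p_1M n H"
proof -
  obtain J where J: "subgraph J H" "max 1 (1 * real (num_edges H)) \<le> num_edges J" "psi n 1 H = p_1M n J"
    using psi_attained[OF assms(1,3), of 1] by auto
  have "edges J \<subseteq> edges H" "simple_graph J" "verts J \<subseteq> verts H" using J(1) by (auto simp: subgraph_def)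
  moreover have "card (edges H) \<le> card (edges J)" using J(2) by (simp add: num_edges_def)
  ultimately have e: "edges J = edges H"
    using card_seteq[OF finite_edges[OF assms(1)]] by blast
  then have "verts H \<subseteq> verts J"
    using no_isolated_verts_eq[OF assms(1,2)] simple_graph_edgeD(1)[OF \<open>simple_graph J\<close>] by blast
  then have "J = H" using e \<open>verts J \<subseteq> verts H\<close> by (intro graph.expand) auto
  then show ?thesis using J(3) by simp
qed

lemma psi_pos:
  fixes q :: real
  assumes "simple_graph H" "1 \<le> num_edges H" "q \<le> 1"
  shows "0 < psi n q H"
proof -
  obtain J where "subgraph J H" "psi n q H = p_1M n J" using psi_attained[OF assms] by metis
  then show ?thesis using p_1M_pos[of J n] by (simp add: subgraph_def)
qed

lemma lambda_one:
  assumes "simple_graph H" "no_isolated_vertices H" "1 \<le> num_edges H"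
  shows "lambda n 1 H = - ln (p_1M n H)"
  using psi_one[OF assms, of n] p_1M_pos[OF assms(1), of n] by (simp add: lambda_def ln_div)

lemma lambda_le_lambda_one:
  fixes q :: real
  assumes "simple_graph H" "no_isolated_vertices H" "1 \<le> num_edges H" "q \<le> 1"
  shows "lambda n q H \<le> lambda n 1 H"
proof -
  have "q * real (num_edges H) \<le> 1 * real (num_edges H)" using assms(4) by (intro mult_right_mono) auto
  then have "p_1M n H \<le> psi n q H"
    using assms subgraph_refl by (intro p_1M_le_psi) auto
  then show ?thesis
    using psi_pos[OF assms(1,3,4), of n] p_1M_pos[OF assms(1), of n] psi_one[OF assms(1-3), of n]
    by (simp add: lambda_def ln_div)
qed

text \<open>Comparisons of \<open>\<lambda>\<^sub>q\<close> with \<open>\<lambda>\<^sub>1\<close> are comparisons of \<open>\<psi>\<^sub>q\<close> with a power of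
\<open>p\<^sub>1\<^sub>M(H)\<close>.\<close>

lemma psi_le_powr:
  fixes q c :: real
  assumes "simple_graph H" "no_isolated_vertices H" "1 \<le> num_edges H" "q \<le> 1"
  shows "c * lambda n 1 H \<le> lambda n q H \<longleftrightarrow> psi n q H \<le> p_1M n H powr c"
    and "lambda n q H \<le> c * lambda n 1 H \<longleftrightarrow> p_1M n H powr c \<le> psi n q H"
proof -
  have pos: "0 < psi n q H" "0 < p_1M n H" using psi_pos[OF assms(1,3,4), of n] p_1M_pos[OF assms(1), of n] by auto
  have l: "lambda n q H = - ln (psi n q H)" using pos by (simp add: lambda_def ln_div)
  have "ln (p_1M n H powr c) = c * ln (p_1M n H)" using pos by (simp add: ln_powr)
  then show "c * lambda n 1 H \<le> lambda n q H \<longleftrightarrow> psi n q H \<le> p_1M n H powr c"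
    "lambda n q H \<le> c * lambda n 1 H \<longleftrightarrow> p_1M n H powr c \<le> psi n q H"
    using pos ln_le_cancel_iff[of "psi n q H" "p_1M n H powr c"]
      ln_le_cancel_iff[of "p_1M n H powr c" "psi n q H"]
    by (simp_all add: l lambda_one[OF assms(1-3)])
qed

lemma copy_count_ge_powr:
  fixes q c :: real
  assumes H: "simple_graph H" "no_isolated_vertices H" "1 \<le> num_edges H" "q \<le> 1"
    and l: "c * lambda n 1 H \<le> lambda n q H"
    and J: "subgraph J H" "max 1 (q * real (num_edges H)) \<le> num_edges J"
  shows "p_1M n H powr (- c * real (num_edges J)) \<le> copy_count n J"
proof -
  have s: "simple_graph J" using J(1) by (simp add: subgraph_def)
  have "p_1M n J \<le> p_1M n H powr c"
    using p_1M_le_psi[OF H(1) J, of n] psi_le_powr(1)[OF H, of c n] l by linarith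
  then have "(p_1M n H powr c) powr (- real (num_edges J)) \<le> p_1M n J powr (- real (num_edges J))"
    using p_1M_pos[OF s] by (intro powr_mono2') auto
  then show ?thesis
    using J(2) copy_count_eq_powr[OF s, of n] by (simp add: powr_powr)
qed

text \<open>For \<open>\<eta> = 0\<close> this is, up to the choice of the common edges, the count that one would get if every subgraph \<open>J\<close> of \<open>H\<close> had threshold
\<open>p\<^sub>1\<^sub>M(H)\<close>; \<open>\<eta>\<close> is the error allowed in the exponent.\<close>

definition overlap_bound :: "nat \<Rightarrow> 'a graph \<Rightarrow> real \<Rightarrow> real \<Rightarrow> bool" where
  "overlap_bound n H q \<eta> \<longleftrightarrow> (\<forall>S\<in>copies n H. \<forall>l. q * real (num_edges H) \<le> real l \<longrightarrow>
     real (card {T \<in> copies n H. card (edges S \<inter> edges T) = l})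
       \<le> card (copies n H) * p_1M n H powr (l - \<eta> * real (num_edges H)))"

text \<open>The lower bound on \<open>\<lambda>\<^sub>q\<close> says that a subgraph with \<open>l \<ge> q k\<close> edges has at least
\<open>B = P powr (- (1 - \<eta>) l)\<close> copies. One loss of \<open>\<eta>\<close> in the exponent comes from there. The other one pays for the
choice of the common part: in the first alternative of \<open>entropy\<close> for a set of common edges, in the second
one for a set of common vertices. In the latter case \<open>m\<close> is the least number of vertices spanned by \<open>l\<close> edges
and \<open>n ^ m\<close>, a bound for the number of copies of the spanned graph, is at least \<open>B\<close>.\<close>

lemma overlap_boundI:
  fixes q \<eta> :: real
  assumes H: "simple_graph H" "no_isolated_vertices H" "num_verts H \<le> n" "1 \<le> num_edges H"
    and q: "0 < q" "q \<le> 1" and \<eta>: "0 \<le> \<eta>" "\<eta> \<le> 1" and P: "p_1M n H < 1"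
    and l: "(1 - \<eta>) * lambda n 1 H \<le> lambda n q H"
    and entropy: "4 ^ num_edges H \<le> p_1M n H powr (- \<eta> * real (num_edges H))
      \<or> real (num_verts H) ^ 2 \<le> real n powr \<eta>"
  shows "overlap_bound n H q (2 * \<eta>)"
  unfolding overlap_bound_def
proof (intro ballI allI impI)
  fix S l assume S: "S \<in> copies n H" and ql: "q * real (num_edges H) \<le> real l"
  let ?k = "num_edges H" let ?P = "p_1M n H" let ?M = "real (card (copies n H))"
  let ?N = "real (card {T \<in> copies n H. card (edges S \<inter> edges T) = l})"
  have P0: "0 < ?P" using p_1M_pos[OF H(1)] .
  show "?N \<le> ?M * ?P powr (l - 2 * \<eta> * ?k)"
  proof (cases "l \<le> ?k")
    case False
    have "card (edges S \<inter> edges T) \<noteq> l" for T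
    proof -
      have "card (edges S \<inter> edges T) \<le> card (edges S)"
        using finite_edges[OF copy_simple[OF S]] by (intro card_mono) auto
      then show ?thesis using False card_copy(1)[OF H(1) S] by simp
    qed
    then have none: "{T \<in> copies n H. card (edges S \<inter> edges T) = l} = {}" by simp
    show ?thesis unfolding none by simp
  next
    case True
    have "0 < q * ?k" using q(1) H(4) by simp
    then have l1: "1 \<le> l" using ql by linarith
    define B where "B = ?P powr (- (1 - \<eta>) * l)"
    have B0: "0 < B" using P0 by (simp add: B_def)
    have cc: "B \<le> copy_count n (Graph (\<Union>F) F)" if "F \<subseteq> edges H" "card F = l" for F
      using copy_count_ge_powr[OF H(1,2,4) q(2) l edge_induced_graph(1)[OF H(1) that(1)]] that ql l1
      by (simp add: num_edges_def B_def)
    show ?thesis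
      using entropy
    proof
      assume ent: "4 ^ ?k \<le> ?P powr (- \<eta> * ?k)"
      have "?N * B \<le> ?M * 4 ^ ?k"
        using overlap_count_edges[OF H(1,3) S _ cc] B0 by simp
      also have "\<dots> \<le> ?M * ?P powr (- \<eta> * ?k)" using ent by (intro mult_left_mono) auto
      finally have "?N * B * ?P powr ((1 - \<eta>) * l) \<le> ?M * ?P powr (- \<eta> * ?k) * ?P powr ((1 - \<eta>) * l)"
        by (rule mult_right_mono) simp
      moreover have "B * ?P powr ((1 - \<eta>) * l) = 1"
        using P0 by (simp add: B_def powr_add[symmetric] algebra_simps)
      ultimately have "?N \<le> ?M * ?P powr (- \<eta> * ?k + (1 - \<eta>) * l)"
        by (simp only: mult.assoc powr_add mult_1_right)
      also have "\<dots> \<le> ?M * ?P powr (l - 2 * \<eta> * ?k)"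
      proof (intro mult_left_mono powr_mono')
        have "\<eta> * l \<le> \<eta> * ?k" using \<eta> True by (intro mult_left_mono) auto
        then show "l - 2 * \<eta> * ?k \<le> - \<eta> * ?k + (1 - \<eta>) * l" by (simp add: algebra_simps)
      qed (use P0 P in auto)
      finally show ?thesis .
    next
      assume ent: "real (num_verts H) ^ 2 \<le> real n powr \<eta>"
      obtain F where F: "F \<subseteq> edges H" "card F = l"
        "\<And>G. G \<subseteq> edges H \<Longrightarrow> card G = l \<Longrightarrow> card (\<Union>F) \<le> card (\<Union>G)"
      proof -
        obtain F' where "F' \<subseteq> edges H" "card F' = l"
          using True by (metis num_edges_def obtain_subset_with_card_n)
        then show thesis
          using ex_has_least_nat[of "\<lambda>F. F \<subseteq> edges H \<and> card F = l" F' "\<lambda>F. card (\<Union>F)"] that by blast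
      qed
      define m where "m = card (\<Union>F)"
      note G = edge_induced_graph[OF H(1) F(1)]
      have mv: "m \<le> num_verts H" using G(4) by (simp add: m_def num_verts_def)
      have Bn: "B \<le> real n ^ m"
        using cc[OF F(1,2)] copy_count_le_power[OF G(3), of n] G(4) H(3)
        by (simp add: m_def num_verts_def)
      then have n0: "0 < real n ^ m" using B0 by linarith
      have "?N * real n ^ m \<le> ?M * real (num_verts H) ^ (2 * m)"
        using overlap_count_vertices[OF H(1,3) S _ mv, of l] F(3) by (simp add: m_def)
      also have "\<dots> \<le> ?M * (real n powr \<eta>) ^ m"
        unfolding power_mult using ent by (intro mult_left_mono power_mono) auto
      also have "(real n powr \<eta>) ^ m = (real n ^ m) powr \<eta>"
        by (induction m) (simp_all add: powr_mult)
      finally have "?N * real n ^ m \<le> ?M * (real n ^ m) powr \<eta>" .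
      then have "?N \<le> ?M * ((real n ^ m) powr \<eta> / real n ^ m)"
        using n0 by (simp add: pos_le_divide_eq)
      also have "(real n ^ m) powr \<eta> / real n ^ m = (real n ^ m) powr (- (1 - \<eta>))"
        using n0 by (simp add: powr_diff)
      also have "?M * \<dots> \<le> ?M * B powr (- (1 - \<eta>))"
        using Bn B0 \<eta> by (intro mult_left_mono powr_mono2') auto
      also have "B powr (- (1 - \<eta>)) = ?P powr ((1 - \<eta>) * l * (1 - \<eta>))"
        by (simp add: B_def powr_powr algebra_simps)
      also have "?M * \<dots> \<le> ?M * ?P powr (l - 2 * \<eta> * ?k)"
      proof (intro mult_left_mono powr_mono')
        have "\<eta> * l \<le> \<eta> * ?k" using \<eta> True by (intro mult_left_mono) auto
        moreover have "0 \<le> \<eta> * \<eta> * l" using \<eta> by simp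
        ultimately show "l - 2 * \<eta> * ?k \<le> (1 - \<eta>) * l * (1 - \<eta>)"
          by (simp add: algebra_simps)
      qed (use P0 P in auto)
      finally show ?thesis .
    qed
  qed
qed

lemma copies_of_subgraph:
  assumes "simple_graph H" "subgraph J H" "S \<in> copies n H"
  obtains T where "T \<in> copies n J" "edges T \<subseteq> edges S"
proof -
  obtain f where f: "f \<in> injections (verts H) n" "S = map_graph f H"
    using assms(3) unfolding copies_eq_image[OF assms(1)] by (rule imageE)
  have J: "simple_graph J" "verts J \<subseteq> verts H" "edges J \<subseteq> edges H"
    using assms(2) by (auto simp: subgraph_def)
  let ?f = "restrict f (verts J)"
  have "inj_on f (verts J)" using f(1) J(2) inj_on_subset unfolding injections_def by blast
  then have "inj_on ?f (verts J)" by (simp add: inj_on_def)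
  moreover have "?f \<in> verts J \<rightarrow>\<^sub>E {..<n}"
    using f(1) J(2) unfolding injections_def by fastforce
  ultimately have "?f \<in> injections (verts J) n" unfolding injections_def by blast
  then have "map_graph ?f J \<in> copies n J" unfolding copies_eq_image[OF J(1)] by (rule imageI)
  moreover have "map_graph ?f J = map_graph f J" by (rule map_graph_cong[OF J(1)]) simp
  ultimately show thesis using that[of "map_graph f J"] f(2) image_mono[OF J(3), of "(`) f"] by simp
qed

context
  fixes H :: "'a graph" and n :: nat and p :: real
  assumes H: "simple_graph H" "no_isolated_vertices H" "num_verts H \<le> n" "1 \<le> num_edges H"
    and p: "0 \<le> p" "p \<le> 1"
begin

interpretation planted_family "edges (complete_graph n)" "edges ` copies n H" "num_edges H" p
  by (rule planted_family_copies[OF H(1-3) p])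

lemma card_edge_sets: "card (edges ` copies n H) = card (copies n H)"
  by (rule card_image[OF inj_on_edges_copies[OF H(1,2)]])

lemma MMSE_nonneg: "0 \<le> MMSE n H p"
  unfolding MMSE_def by (intro integral_nonneg_AE AE_I2) (auto intro!: sum_nonneg)

lemma MMSE_le: "MMSE n H p \<le> num_edges H"
  using mmse_le[of "edges ` copies n H" 0] finite_family members
  by (simp add: MMSE_eq_mmse[OF H(1-3) p] mult_less_0_iff) blast

lemma sum_by_overlap:
  fixes g :: "nat \<Rightarrow> real"
  assumes "h \<in> edges ` copies n H"
  shows "(\<Sum>h'\<in>{h' \<in> edges ` copies n H. Q (card (h \<inter> h'))}. g (card (h \<inter> h')))
    = (\<Sum>l\<in>{l. l \<le> num_edges H \<and> Q l}. card {h' \<in> edges ` copies n H. card (h \<inter> h') = l} * g l)"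
proof -
  let ?F = "edges ` copies n H"
  have "(\<Sum>h'\<in>{h' \<in> ?F. Q (card (h \<inter> h'))}. g (card (h \<inter> h')))
    = (\<Sum>l\<in>{l. l \<le> num_edges H \<and> Q l}. \<Sum>h'\<in>{h' \<in> {h' \<in> ?F. Q (card (h \<inter> h'))}. card (h \<inter> h') = l}. g (card (h \<inter> h')))"
    using finite_family card_union_members(3)[OF assms]
    by (intro sum.group[symmetric]) auto
  also have "\<dots> = (\<Sum>l\<in>{l. l \<le> num_edges H \<and> Q l}. card {h' \<in> ?F. card (h \<inter> h') = l} * g l)"
  proof (intro sum.cong refl)
    fix l assume "l \<in> {l. l \<le> num_edges H \<and> Q l}"
    then have "{h' \<in> {h' \<in> ?F. Q (card (h \<inter> h'))}. card (h \<inter> h') = l} = {h' \<in> ?F. card (h \<inter> h') = l}"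
      by auto
    then show "(\<Sum>h'\<in>{h' \<in> {h' \<in> ?F. Q (card (h \<inter> h'))}. card (h \<inter> h') = l}. g (card (h \<inter> h')))
        = card {h' \<in> ?F. card (h \<inter> h') = l} * g l" by simp
  qed
  finally show ?thesis .
qed

lemma sum_by_overlap_le:
  fixes g :: "nat \<Rightarrow> real" and b :: real
  assumes h: "h \<in> edges ` copies n H" and b: "0 \<le> b" "\<And>l. 0 \<le> g l"
    and le: "\<And>l S. S \<in> copies n H \<Longrightarrow> l \<le> num_edges H \<Longrightarrow> Q l \<Longrightarrow>
      card {T \<in> copies n H. card (edges S \<inter> edges T) = l} * g l \<le> b"
  shows "(\<Sum>h'\<in>{h' \<in> edges ` copies n H. Q (card (h \<inter> h'))}. g (card (h \<inter> h')))
    \<le> (num_edges H + 1) * b"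
proof -
  obtain S where S: "S \<in> copies n H" "h = edges S" using h by (rule imageE)
  have fin: "finite (copies n H)" using copies_finite_nonempty H by auto
  have "(\<Sum>l\<in>{l. l \<le> num_edges H \<and> Q l}. card {h' \<in> edges ` copies n H. card (h \<inter> h') = l} * g l)
      \<le> (\<Sum>l\<in>{l. l \<le> num_edges H \<and> Q l}. b)"
  proof (rule sum_mono)
    fix l assume l: "l \<in> {l. l \<le> num_edges H \<and> Q l}"
    have "{h' \<in> edges ` copies n H. card (h \<inter> h') = l}
        = edges ` {T \<in> copies n H. card (edges S \<inter> edges T) = l}" using S(2) by auto
    then have "card {h' \<in> edges ` copies n H. card (h \<inter> h') = l}
        \<le> card {T \<in> copies n H. card (edges S \<inter> edges T) = l}"
      using fin by (simp add: card_image_le)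
    then have "card {h' \<in> edges ` copies n H. card (h \<inter> h') = l} * g l
        \<le> card {T \<in> copies n H. card (edges S \<inter> edges T) = l} * g l"
      by (intro mult_right_mono b) simp
    then show "card {h' \<in> edges ` copies n H. card (h \<inter> h') = l} * g l \<le> b"
      using le[OF S(1), of l] l by simp
  qed
  also have "\<dots> = card {l. l \<le> num_edges H \<and> Q l} * b" by simp
  also have "card {l. l \<le> num_edges H \<and> Q l} \<le> card {..num_edges H}" by (intro card_mono) auto
  then have "card {l. l \<le> num_edges H \<and> Q l} * b \<le> (num_edges H + 1) * b"
    using b(1) by (intro mult_right_mono) auto
  finally show ?thesis by (simp only: sum_by_overlap[OF h])
qed

text \<open>With \<open>p \<ge> P powr (1 - \<epsilon>)\<close>, the \<open>M P powr (l - \<eta> k)\<close> copies with overlap \<open>l\<close> each contribute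
\<open>p powr (-l)\<close>, which is at most \<open>P powr (-(1 - \<epsilon>) l)\<close>. Relative to \<open>M\<close> this leaves
\<open>P powr (\<epsilon> l - \<eta> k)\<close>, exponentially small for \<open>l \<ge> q k\<close> if \<open>\<eta> < \<epsilon> q\<close>. The parameter \<open>t\<close> of
\<open>mmse_ge\<close> is chosen to balance the two error terms.\<close>

lemma MMSE_ratio_ge:
  fixes q \<eta> \<epsilon> :: real
  assumes ob: "overlap_bound n H q \<eta>" and q: "0 \<le> q" and P: "p_1M n H < 1"
    and \<epsilon>: "0 \<le> \<epsilon>" and pP: "p_1M n H powr (1 - \<epsilon>) \<le> p"
  shows "1 - q - 2 * sqrt ((num_edges H + 1) * p_1M n H powr ((\<epsilon> * q - \<eta>) * real (num_edges H)))
    \<le> MMSE n H p / num_edges H"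
proof -
  let ?F = "edges ` copies n H"
  define k where "k = num_edges H"
  define P where "P = p_1M n H"
  define M where "M = real (card ?F)"
  define b where "b = P powr ((\<epsilon> * q - \<eta>) * k)"
  define x where "x = (k + 1) * b"
  have P0: "0 < P" "P < 1" using p_1M_pos[OF H(1)] assms(3) by (auto simp: P_def)
  have "0 < P powr (1 - \<epsilon>)" using P0 by simp
  then have p0: "0 < p" using pP unfolding P_def by linarith
  have M0: "0 < M" using card_family_pos by (simp add: M_def)
  have b0: "0 < b" using P0 by (simp add: b_def)
  have x0: "0 < x" using b0 by (simp add: x_def)
  have k0: "0 < k" using H(4) by (simp add: k_def)
  have inner: "(\<Sum>h'\<in>{h' \<in> ?F. q * k \<le> card (h \<inter> h')}. (1 / p) ^ card (h \<inter> h')) \<le> (k + 1) * (M * b)"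
    if h: "h \<in> ?F" for h
    unfolding k_def
  proof (rule sum_by_overlap_le[OF h])
    fix l S assume S: "S \<in> copies n H" and l: "q * real (num_edges H) \<le> real l"
    have "1 / p \<le> 1 / P powr (1 - \<epsilon>)"
      using pP P0 p0 unfolding P_def by (intro divide_left_mono) auto
    also have "\<dots> = P powr (- (1 - \<epsilon>))" by (simp add: powr_minus_divide[symmetric])
    finally have "(1 / p) ^ l \<le> (P powr (- (1 - \<epsilon>))) ^ l"
      using p0 by (intro power_mono) auto
    also have "\<dots> = P powr (- (1 - \<epsilon>) * l)" using P0 by (simp add: powr_power mult.commute)
    finally have pl: "(1 / p) ^ l \<le> P powr (- (1 - \<epsilon>) * l)" .
    have "card {T \<in> copies n H. card (edges S \<inter> edges T) = l} * (1 / p) ^ l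
        \<le> (M * P powr (l - \<eta> * k)) * P powr (- (1 - \<epsilon>) * l)"
      using ob S l pl p0 M0 unfolding overlap_bound_def M_def P_def k_def card_edge_sets
      by (intro mult_mono) auto
    also have "\<dots> = M * P powr (\<epsilon> * l - \<eta> * k)"
      by (simp add: mult.assoc powr_add[symmetric] algebra_simps)
    also have "\<dots> \<le> M * b"
      unfolding b_def
    proof (intro mult_left_mono powr_mono')
      have "\<epsilon> * (q * k) \<le> \<epsilon> * l" using l \<epsilon> by (intro mult_left_mono) (auto simp: k_def)
      then show "(\<epsilon> * q - \<eta>) * k \<le> \<epsilon> * l - \<eta> * k" by (simp add: algebra_simps)
    qed (use P0 M0 in auto)
    finally show "card {T \<in> copies n H. card (edges S \<inter> edges T) = l} * (1 / p) ^ l \<le> M * b" .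
  qed (use M0 b0 p0 in auto)
  have "(\<Sum>h\<in>?F. \<Sum>h'\<in>{h' \<in> ?F. q * k \<le> card (h \<inter> h')}. (1 / p) ^ card (h \<inter> h'))
      \<le> (\<Sum>h\<in>?F. (k + 1) * (M * b))" by (intro sum_mono inner)
  also have "\<dots> = M\<^sup>2 * x" by (simp add: M_def x_def power2_eq_square)
  finally have "(\<Sum>h\<in>?F. \<Sum>h'\<in>{h' \<in> ?F. q * k \<le> card (h \<inter> h')}. (1 / p) ^ card (h \<inter> h')) / M\<^sup>2 \<le> x"
    using M0 by (simp add: divide_le_eq mult.commute)
  then have "(1 / sqrt x) * ((\<Sum>h\<in>?F. \<Sum>h'\<in>{h' \<in> ?F. q * k \<le> card (h \<inter> h')}. (1 / p) ^ card (h \<inter> h')) / M\<^sup>2)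
      \<le> (1 / sqrt x) * x" using x0 by (intro mult_left_mono) auto
  also have "\<dots> = sqrt x" using x0 by (simp add: real_div_sqrt)
  finally have "k * (sqrt x + (1 / sqrt x) * ((\<Sum>h\<in>?F. \<Sum>h'\<in>{h' \<in> ?F. q * k \<le> card (h \<inter> h')}. (1 / p) ^ card (h \<inter> h')) / M\<^sup>2))
      \<le> k * (sqrt x + sqrt x)" by (intro mult_left_mono) auto
  moreover have "real k - mmse \<le> q * k + k * (sqrt x + (1 / sqrt x) *
    ((\<Sum>h\<in>?F. \<Sum>h'\<in>{h' \<in> ?F. q * k \<le> card (h \<inter> h')}. (1 / p) ^ card (h \<inter> h')) / M\<^sup>2))"
    using mmse_ge[OF p0 _ q, of "sqrt x"] x0 unfolding k_def M_def by simp
  ultimately have "real k - mmse \<le> q * k + k * (sqrt x + sqrt x)" by linarith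
  then have "(1 - q - 2 * sqrt x) * k \<le> mmse" by (simp add: algebra_simps)
  then have "1 - q - 2 * sqrt x \<le> mmse / k" using k0 by (simp add: pos_le_divide_eq)
  then show ?thesis
    unfolding MMSE_eq_mmse[OF H(1-3) p] x_def b_def k_def P_def .
qed

text \<open>The expected number of copies in the observation with overlap \<open>l < d k\<close> is bounded by \<open>P powr (a k)\<close>: for
\<open>l \<ge> q k\<close> through the overlap count, and for smaller \<open>l\<close> because all \<open>M = P powr (-k)\<close> copies together
contribute too little. The two conditions on \<open>a\<close> correspond to these two ranges.\<close>

lemma MMSE_ratio_le:
  fixes q \<eta> \<epsilon> d a :: real
  assumes ob: "overlap_bound n H q \<eta>" and P: "p_1M n H < 1" and d: "0 \<le> d" "d \<le> 1"
    and \<epsilon>: "0 \<le> \<epsilon>" and pP: "p \<le> p_1M n H powr (1 + \<epsilon>)"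
    and a: "a \<le> \<epsilon> * (1 - d) - \<eta>" "a \<le> \<epsilon> - (1 + \<epsilon>) * q"
  shows "MMSE n H p / num_edges H \<le> (1 - d) + (num_edges H + 1) * p_1M n H powr (a * real (num_edges H))"
proof -
  let ?F = "edges ` copies n H"
  define k where "k = num_edges H"
  define P where "P = p_1M n H"
  define M where "M = real (card ?F)"
  have P0: "0 < P" "P < 1" using p_1M_pos[OF H(1)] assms(2) by (auto simp: P_def)
  have M0: "0 < M" using card_family_pos by (simp add: M_def)
  have k0: "0 < k" using H(4) by (simp add: k_def)
  have MP: "M = P powr (- real k)"
    using card_copies[OF H(1,3)] copy_count_eq_powr[OF H(1,4), of n]
    by (simp add: M_def card_edge_sets P_def k_def)
  have inner: "(\<Sum>j\<in>{j \<in> ?F. card (j \<inter> h) < d * k}. p ^ card (j - h)) \<le> (k + 1) * P powr (a * k)"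
    if h: "h \<in> ?F" for h
  proof -
    have "(\<Sum>j\<in>{j \<in> ?F. card (j \<inter> h) < d * k}. p ^ card (j - h))
        = (\<Sum>j\<in>{j \<in> ?F. card (h \<inter> j) < d * k}. p ^ (k - card (h \<inter> j)))"
    proof (intro sum.cong)
      fix j assume "j \<in> {j \<in> ?F. card (h \<inter> j) < d * k}"
      then have j: "j \<in> ?F" by simp
      have "card (j - h) = card j - card (j \<inter> h)"
        using finite_member[OF j] by (simp add: card_Diff_subset_Int)
      then show "p ^ card (j - h) = p ^ (k - card (h \<inter> j))"
        using members[OF j] by (simp add: k_def Int_commute)
    qed (simp add: Int_commute)
    also have "\<dots> \<le> (k + 1) * P powr (a * k)"
      unfolding k_def
    proof (rule sum_by_overlap_le[OF h])
      fix l S assume S: "S \<in> copies n H" and l: "l \<le> num_edges H" "real l < d * real (num_edges H)"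
      let ?N = "card {T \<in> copies n H. card (edges S \<inter> edges T) = l}"
      have "p ^ (k - l) \<le> (P powr (1 + \<epsilon>)) ^ (k - l)"
        using pP p by (intro power_mono) (auto simp: P_def)
      also have "\<dots> = P powr ((1 + \<epsilon>) * (real k - l))"
        using P0 l by (simp add: powr_power mult.commute of_nat_diff k_def)
      finally have pl: "p ^ (k - l) \<le> P powr ((1 + \<epsilon>) * (real k - l))" .
      show "?N * p ^ (num_edges H - l) \<le> P powr (a * real (num_edges H))"
      proof (cases "q * k \<le> real l")
        case True
        have "?N * p ^ (k - l) \<le> (M * P powr (l - \<eta> * k)) * P powr ((1 + \<epsilon>) * (real k - l))"
          using ob S True pl p M0 unfolding overlap_bound_def M_def P_def k_def card_edge_sets
          by (intro mult_mono) auto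
        also have "\<dots> = P powr (\<epsilon> * (real k - l) - \<eta> * k)"
          unfolding MP by (simp add: powr_add[symmetric] algebra_simps)
        also have "\<dots> \<le> P powr (a * k)"
        proof (rule powr_mono')
          have "\<epsilon> * (real k - d * k) \<le> \<epsilon> * (real k - l)"
            using l(2) \<epsilon> by (intro mult_left_mono) (auto simp: k_def)
          moreover have "a * k \<le> (\<epsilon> * (1 - d) - \<eta>) * k" using a(1) by (intro mult_right_mono) auto
          ultimately show "a * k \<le> \<epsilon> * (real k - l) - \<eta> * k" by (simp add: algebra_simps)
        qed (use P0 in auto)
        finally show ?thesis by (simp add: k_def)
      next
        case False
        have "?N \<le> card (copies n H)"
          using copies_finite_nonempty(1)[OF H(1,3)] by (intro card_mono) auto
        then have "?N * p ^ (k - l) \<le> M * P powr ((1 + \<epsilon>) * (real k - l))"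
          using pl p M0 unfolding M_def card_edge_sets by (intro mult_mono) auto
        also have "\<dots> = P powr (\<epsilon> * k - (1 + \<epsilon>) * l)"
          unfolding MP by (simp add: powr_add[symmetric] algebra_simps)
        also have "\<dots> \<le> P powr (a * k)"
        proof (rule powr_mono')
          have "(1 + \<epsilon>) * l \<le> (1 + \<epsilon>) * (q * k)"
            using False \<epsilon> by (intro mult_left_mono) auto
          moreover have "a * k \<le> (\<epsilon> - (1 + \<epsilon>) * q) * k" using a(2) by (intro mult_right_mono) auto
          ultimately show "a * k \<le> \<epsilon> * k - (1 + \<epsilon>) * l" by (simp add: algebra_simps)
        qed (use P0 in auto)
        finally show ?thesis by (simp add: k_def)
      qed
    qed (use p in auto)
    finally show ?thesis .
  qed
  have "mmse \<le> (1 - d) * k + k / M * (\<Sum>h\<in>?F. \<Sum>j\<in>{j \<in> ?F. card (j \<inter> h) < d * k}. p ^ card (j - h))"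
    unfolding k_def M_def using members by (intro mmse_le finite_family d) blast+
  also have "\<dots> \<le> (1 - d) * k + k / M * (\<Sum>h\<in>?F. (k + 1) * P powr (a * k))"
    using M0 by (intro add_left_mono mult_left_mono sum_mono inner) auto
  also have "\<dots> = ((1 - d) + (k + 1) * P powr (a * k)) * k"
    using M0 by (simp add: M_def[symmetric] algebra_simps)
  finally have "mmse / k \<le> (1 - d) + (k + 1) * P powr (a * k)"
    using k0 by (simp add: divide_le_eq)
  then show ?thesis unfolding MMSE_eq_mmse[OF H(1-3) p] k_def P_def .
qed

text \<open>If \<open>J\<close> has few copies, then for \<open>p\<close> below the threshold of \<open>J\<close> it is likely that all copies of
\<open>J\<close> in the observation meet the planted copy in at least \<open>d k\<close> edges. Every posterior sample contains one of them.\<close>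

lemma MMSE_ratio_le_subgraph:
  fixes d s r :: real
  assumes J: "subgraph J H" and P: "p_1M n H < 1" and d: "0 \<le> d" "d \<le> 1" and s: "0 \<le> s"
    and pP: "p \<le> p_1M n H powr s"
    and cc: "copy_count n J \<le> p_1M n H powr (- r * real (num_edges J))"
  shows "MMSE n H p / num_edges H
    \<le> (1 - d) + p_1M n H powr ((s - r) * real (num_edges J) - s * d * real (num_edges H))"
proof -
  let ?F = "edges ` copies n H" and ?J = "edges ` copies n J"
  define k where "k = num_edges H"
  define P where "P = p_1M n H"
  define M where "M = real (card ?F)"
  define b where "b = P powr (s * (num_edges J - d * k))"
  have P0: "0 < P" "P < 1" using p_1M_pos[OF H(1)] assms(2) by (auto simp: P_def)
  have M0: "0 < M" using card_family_pos by (simp add: M_def)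
  have k0: "0 < k" using H(4) by (simp add: k_def)
  have sJ: "simple_graph J" using J by (simp add: subgraph_def)
  have "num_verts J \<le> num_verts H"
    using J H(1) card_mono by (auto simp: subgraph_def num_verts_def simple_graph_def)
  then have vJ: "num_verts J \<le> n" using H(3) by simp
  note finJ = copies_finite_nonempty(1)[OF sJ vJ]
  have inner: "(\<Sum>j\<in>{j \<in> ?J. card (j \<inter> h) < d * k}. p ^ card (j - h)) \<le> copy_count n J * b" for h
  proof -
    have "(\<Sum>j\<in>{j \<in> ?J. card (j \<inter> h) < d * k}. p ^ card (j - h)) \<le> (\<Sum>j\<in>{j \<in> ?J. card (j \<inter> h) < d * k}. b)"
    proof (rule sum_mono)
      fix j assume j: "j \<in> {j \<in> ?J. card (j \<inter> h) < d * k}"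
      then obtain T where T: "T \<in> copies n J" "j = edges T" by auto
      have fj: "finite j" "card j = num_edges J"
        using T finite_edges[OF copy_simple] card_copy(1)[OF sJ] by auto
      have "card (j - h) = card j - card (j \<inter> h)" "card (j \<inter> h) \<le> card j"
        using fj(1) by (auto simp: card_Diff_subset_Int intro!: card_mono)
      then have ge: "num_edges J - d * k \<le> card (j - h)" using j fj(2) by simp
      have "p ^ card (j - h) \<le> (P powr s) ^ card (j - h)"
        using pP p by (intro power_mono) (auto simp: P_def)
      also have "\<dots> = P powr (s * card (j - h))" using P0 by (simp add: powr_power mult.commute)
      also have "\<dots> \<le> b" unfolding b_def using ge s P0 by (intro powr_mono' mult_left_mono) auto
      finally show "p ^ card (j - h) \<le> b" .
    qed
    also have "\<dots> = card {j \<in> ?J. card (j \<inter> h) < d * k} * b" by simp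
    also have "\<dots> \<le> copy_count n J * b"
    proof (rule mult_right_mono)
      have "card {j \<in> ?J. card (j \<inter> h) < d * k} \<le> card ?J" using finJ by (intro card_mono) auto
      also have "\<dots> \<le> card (copies n J)" by (rule card_image_le[OF finJ])
      finally show "card {j \<in> ?J. card (j \<inter> h) < d * k} \<le> copy_count n J"
        using card_copies[OF sJ vJ] by linarith
    qed (simp add: b_def)
    finally show ?thesis .
  qed
  have "mmse \<le> (1 - d) * k + k / M * (\<Sum>h\<in>?F. \<Sum>j\<in>{j \<in> ?J. card (j \<inter> h) < d * k}. p ^ card (j - h))"
    unfolding k_def M_def
  proof (intro mmse_le d)
    show "finite ?J" using finJ by simp
    show "j \<subseteq> edges (complete_graph n)" if "j \<in> ?J" for j
      using that copy_edges_subset by (elim imageE) simp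
    show "\<exists>j\<in>?J. j \<subseteq> h" if "h \<in> ?F" for h
    proof -
      obtain S where S: "S \<in> copies n H" "h = edges S" using \<open>h \<in> ?F\<close> by (rule imageE)
      obtain T where "T \<in> copies n J" "edges T \<subseteq> edges S"
        by (rule copies_of_subgraph[OF H(1) J S(1)])
      then show ?thesis unfolding S(2) by (intro bexI[of _ "edges T"] imageI)
    qed
  qed
  also have "\<dots> \<le> (1 - d) * k + k / M * (\<Sum>h\<in>?F. copy_count n J * b)"
    using M0 by (intro add_left_mono mult_left_mono sum_mono inner) auto
  also have "\<dots> = ((1 - d) + copy_count n J * b) * k"
    using M0 by (simp add: M_def[symmetric] algebra_simps)
  also have "\<dots> \<le> ((1 - d) + P powr (- r * real (num_edges J)) * b) * k"
    using cc by (intro mult_right_mono add_left_mono) (auto simp: b_def P_def)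
  finally have "mmse / k \<le> (1 - d) + P powr (- r * real (num_edges J)) * b"
    using k0 by (simp add: divide_le_eq)
  also have "P powr (- r * real (num_edges J)) * b = P powr ((s - r) * real (num_edges J) - s * d * k)"
    by (simp add: b_def powr_add[symmetric] algebra_simps)
  finally show ?thesis unfolding MMSE_eq_mmse[OF H(1-3) p] k_def P_def .
qed

end

section \<open>Asymptotics\<close>

lemma exponential_decay:
  assumes k: "filterlim k at_top sequentially" and c: "c < 1"
    and P: "\<forall>\<^sub>F n in sequentially. 0 < P n \<and> P n \<le> c" and a: "0 < a"
  shows "(\<lambda>n. (real (k n) + 1) * P n powr (a * real (k n))) \<longlonglongrightarrow> 0"
proof -
  have c0: "0 < c" using eventually_happens'[OF _ P] by fastforce
  define b where "b = a * - ln c"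
  have b: "0 < b" unfolding b_def using c c0 a by (intro mult_pos_pos) simp_all
  have "((\<lambda>x. (x + 1) * exp (- b * x)) \<longlongrightarrow> 0) at_top" using b by real_asymp
  then have lim: "(\<lambda>n. (real (k n) + 1) * exp (- b * real (k n))) \<longlonglongrightarrow> 0"
    by (rule filterlim_compose) (rule filterlim_compose[OF filterlim_real_sequentially k])
  show ?thesis
  proof (rule tendsto_sandwich[OF _ _ tendsto_const lim])
    show "\<forall>\<^sub>F n in sequentially. 0 \<le> (real (k n) + 1) * P n powr (a * real (k n))" by simp
    show "\<forall>\<^sub>F n in sequentially. (real (k n) + 1) * P n powr (a * real (k n))
        \<le> (real (k n) + 1) * exp (- b * real (k n))"
      using P
    proof eventually_elim
      case (elim n)
      have "P n powr (a * real (k n)) \<le> c powr (a * real (k n))"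
        using elim a by (intro powr_mono2) auto
      also have "\<dots> = exp (- b * real (k n))" using c0 by (simp add: powr_def b_def mult_ac)
      finally show ?case by (intro mult_left_mono) auto
    qed
  qed
qed

context
  fixes H :: "nat \<Rightarrow> 'a graph"
  assumes simple: "\<And>n. n \<ge> 1 \<Longrightarrow> simple_graph (H n)"
    and noiso: "\<And>n. n \<ge> 1 \<Longrightarrow> no_isolated_vertices (H n)"
    and verts_le: "\<And>n. n \<ge> 1 \<Longrightarrow> num_verts (H n) \<le> n"
    and edges_top: "filterlim (\<lambda>n. num_edges (H n)) at_top sequentially"
    and bounded: "bounded_away_from_one (\<lambda>n. p_1M n (H n))"
begin

abbreviation (input) "P n \<equiv> p_1M n (H n)"
abbreviation (input) "k n \<equiv> num_edges (H n)"

lemma eventually_graph: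
  "\<forall>\<^sub>F n in sequentially. simple_graph (H n) \<and> no_isolated_vertices (H n) \<and>
     num_verts (H n) \<le> n \<and> 1 \<le> k n \<and> 1 \<le> n"
proof -
  have "\<forall>\<^sub>F n in sequentially. 1 \<le> k n" using edges_top by (simp add: filterlim_at_top)
  with eventually_ge_at_top[of 1] show ?thesis
    by eventually_elim (use simple noiso verts_le in auto)
qed

lemma p_1M_bound:
  obtains c where "c < 1" "\<forall>\<^sub>F n in sequentially. 0 < P n \<and> P n \<le> c"
proof -
  obtain c where c: "c < 1" "\<forall>\<^sub>F n in sequentially. P n \<le> c"
    using bounded by (auto simp: bounded_away_from_one_def)
  have "\<forall>\<^sub>F n in sequentially. 0 < P n \<and> P n \<le> c"
    using c(2) eventually_graph by eventually_elim (use p_1M_pos in auto)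
  then show thesis using c(1) that by blast
qed

lemma eventually_p_1M: "\<forall>\<^sub>F n in sequentially. 0 < P n \<and> P n < 1"
proof -
  obtain c where c: "c < 1" "\<forall>\<^sub>F n in sequentially. 0 < P n \<and> P n \<le> c" by (rule p_1M_bound)
  from c(2) show ?thesis by eventually_elim (use c(1) in auto)
qed

lemma decay:
  assumes "0 < a"
  shows "(\<lambda>n. (real (k n) + 1) * P n powr (a * real (k n))) \<longlonglongrightarrow> 0"
proof -
  obtain c where c: "c < 1" "\<forall>\<^sub>F n in sequentially. 0 < P n \<and> P n \<le> c" by (rule p_1M_bound)
  show ?thesis by (rule exponential_decay[OF edges_top c assms])
qed

lemma eventually_lambda_one_pos: "\<forall>\<^sub>F n in sequentially. 0 < lambda n 1 (H n)"
  using eventually_graph eventually_p_1M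
proof eventually_elim
  case (elim n)
  then show ?case using lambda_one[of "H n" n] by simp
qed

text \<open>Stability provides some \<open>q\<close> close to 1 that works for all large \<open>n\<close> at once.\<close>

lemma stable_lower:
  assumes stable: "first_moment_stable H" and \<eta>: "0 < \<eta>"
  obtains q where "1 / 2 < q" "q < 1"
    "\<forall>\<^sub>F n in sequentially. (1 - \<eta>) * lambda n 1 (H n) \<le> lambda n q (H n)"
proof -
  obtain N where N: "uniform_limit {N..} (\<lambda>q n. lambda n q (H n) / lambda n 1 (H n)) (\<lambda>_. 1) (at_left 1)"
    using stable by (auto simp: first_moment_stable_def)
  have "\<forall>\<^sub>F q in at_left 1. \<forall>n\<in>{N..}. dist (lambda n q (H n) / lambda n 1 (H n)) 1 < \<eta>"
    by (rule uniform_limitD[OF N \<eta>])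
  moreover have "\<forall>\<^sub>F q in at_left (1::real). 1 / 2 < q \<and> q < 1"
    using eventually_at_left_real[of "1/2" 1] by simp
  ultimately have "\<forall>\<^sub>F q in at_left 1. 1 / 2 < q \<and> q < 1 \<and>
      (\<forall>n\<in>{N..}. dist (lambda n q (H n) / lambda n 1 (H n)) 1 < \<eta>)"
    by eventually_elim auto
  then obtain q where q: "1 / 2 < q" "q < 1"
    "\<forall>n\<in>{N..}. dist (lambda n q (H n) / lambda n 1 (H n)) 1 < \<eta>"
    using eventually_happens' trivial_limit_at_left_real by blast
  have "\<forall>\<^sub>F n in sequentially. (1 - \<eta>) * lambda n 1 (H n) \<le> lambda n q (H n)"
    using eventually_lambda_one_pos eventually_ge_at_top[of N]
  proof eventually_elim
    case (elim n)
    then have "1 - \<eta> \<le> lambda n q (H n) / lambda n 1 (H n)"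
      using bspec[OF q(3), of n] by (simp add: dist_real_def abs_less_iff)
    then show ?case using elim(1) by (simp add: pos_le_divide_eq)
  qed
  then show thesis using that q by blast
qed

text \<open>Flatness compares \<open>\<lambda>\<^sub>q\<close> with \<open>\<lambda>\<^sub>q\<^sub>'\<close> only for \<open>q' < 1\<close>; stability bridges
the gap from \<open>q'\<close> to 1.\<close>

lemma flat_lower:
  assumes flat: "first_moment_flat H" and stable: "first_moment_stable H"
    and q: "0 < q" "q < 1" and \<eta>: "0 < \<eta>"
  shows "\<forall>\<^sub>F n in sequentially. (1 - \<eta>) * lambda n 1 (H n) \<le> lambda n q (H n)"
proof -
  define r where "r = min (\<eta> / 2) (1 / 2)"
  have r: "0 < r" "r \<le> 1 / 2" "2 * r \<le> \<eta>" using \<eta> by (auto simp: r_def)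
  obtain q' where q': "1 / 2 < q'" "q' < 1"
    "\<forall>\<^sub>F n in sequentially. (1 - r) * lambda n 1 (H n) \<le> lambda n q' (H n)"
    using stable_lower[OF stable r(1)] .
  have "(\<lambda>n. lambda n q (H n) / lambda n q' (H n)) \<longlonglongrightarrow> 1"
    using flat q q' by (auto simp: first_moment_flat_def)
  then have "\<forall>\<^sub>F n in sequentially. 1 - r < lambda n q (H n) / lambda n q' (H n)"
    by (rule order_tendstoD) (use r in simp)
  with q'(3) eventually_lambda_one_pos show ?thesis
  proof eventually_elim
    case (elim n)
    have "0 < (1 - r) * lambda n 1 (H n)" using elim(2) r by (intro mult_pos_pos) auto
    then have pos: "0 < lambda n q' (H n)" using elim(1) by linarith
    have "1 - \<eta> \<le> (1 - r) * (1 - r)"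
    proof -
      have "(1 - r) * (1 - r) = 1 - 2 * r + r * r" by (simp add: algebra_simps)
      then show ?thesis using r zero_le_square[of r] by linarith
    qed
    then have "(1 - \<eta>) * lambda n 1 (H n) \<le> (1 - r) * (1 - r) * lambda n 1 (H n)"
      using elim(2) by (intro mult_right_mono) auto
    also have "\<dots> \<le> (1 - r) * lambda n q' (H n)"
      using elim(1) r by (simp add: mult.assoc mult_left_mono)
    also have "\<dots> \<le> lambda n q (H n)" using elim(3) pos by (simp add: pos_less_divide_eq)
    finally show ?case .
  qed
qed

context
  assumes sparse: "P \<longlonglongrightarrow> 0 \<or>
         (\<exists>\<delta> :: nat \<Rightarrow> real. \<delta> \<longlonglongrightarrow> 0 \<and>
            (\<forall>\<^sub>F n in sequentially. real (num_verts (H n)) \<le> real n powr \<delta> n))"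
begin

text \<open>This is where the alternative between vanishing threshold and few vertices enters.\<close>

lemma eventually_entropy:
  assumes "0 < \<eta>"
  shows "\<forall>\<^sub>F n in sequentially. 4 ^ k n \<le> P n powr (- \<eta> * real (k n))
      \<or> real (num_verts (H n)) ^ 2 \<le> real n powr \<eta>"
  using sparse
proof
  assume "P \<longlonglongrightarrow> 0"
  then have "\<forall>\<^sub>F n in sequentially. P n < (1 / 4) powr (1 / \<eta>)"
    by (rule order_tendstoD) simp
  with eventually_p_1M show ?thesis
  proof eventually_elim
    case (elim n)
    have "P n powr \<eta> \<le> ((1 / 4) powr (1 / \<eta>)) powr \<eta>"
      using elim assms by (intro powr_mono2) auto
    also have "\<dots> = 1 / 4" using assms by (simp add: powr_powr)
    finally have "4 \<le> P n powr (- \<eta>)" using elim by (simp add: powr_minus field_simps)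
    then have "4 ^ k n \<le> (P n powr (- \<eta>)) ^ k n" by (intro power_mono) auto
    also have "\<dots> = P n powr (- \<eta> * real (k n))" using elim by (simp add: powr_power mult.commute)
    finally show ?case ..
  qed
next
  assume "\<exists>\<delta> :: nat \<Rightarrow> real. \<delta> \<longlonglongrightarrow> 0 \<and>
            (\<forall>\<^sub>F n in sequentially. real (num_verts (H n)) \<le> real n powr \<delta> n)"
  then obtain \<delta> :: "nat \<Rightarrow> real" where \<delta>: "\<delta> \<longlonglongrightarrow> 0"
    "\<forall>\<^sub>F n in sequentially. real (num_verts (H n)) \<le> real n powr \<delta> n" by blast
  have "\<forall>\<^sub>F n in sequentially. \<delta> n < \<eta> / 2"
    using \<delta>(1) by (rule order_tendstoD) (use assms in simp)
  with \<delta>(2) eventually_graph show ?thesis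
  proof eventually_elim
    case (elim n)
    have "real (num_verts (H n)) ^ 2 \<le> (real n powr \<delta> n) ^ 2"
      using elim by (intro power_mono) auto
    also have "\<dots> = real n powr (\<delta> n * 2)" using elim by (simp add: powr_power mult.commute)
    also have "\<dots> \<le> real n powr \<eta>" using elim by (intro powr_mono) auto
    finally show ?case ..
  qed
qed

lemma eventually_overlap_bound:
  assumes q: "0 < q" "q \<le> 1" and \<eta>: "0 < \<eta>" "\<eta> \<le> 1"
    and l: "\<forall>\<^sub>F n in sequentially. (1 - \<eta> / 2) * lambda n 1 (H n) \<le> lambda n q (H n)"
  shows "\<forall>\<^sub>F n in sequentially. overlap_bound n (H n) q \<eta>"
proof -
  have "0 < \<eta> / 2" using \<eta> by simp
  from l eventually_entropy[OF this] eventually_graph eventually_p_1M show ?thesis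
  proof eventually_elim
    case (elim n)
    then show ?case
      using overlap_boundI[of "H n" n q "\<eta> / 2"] q \<eta> by simp
  qed
qed

lemma eventually_MMSE_ratio_ge:
  assumes q: "0 < q" "q \<le> 1" and \<eta>: "0 < \<eta>" "\<eta> \<le> 1" "\<eta> < \<epsilon> * q" and \<epsilon>: "0 < \<epsilon>"
    and l: "\<forall>\<^sub>F n in sequentially. (1 - \<eta> / 2) * lambda n 1 (H n) \<le> lambda n q (H n)"
    and p: "\<And>n. 0 \<le> p n \<and> p n \<le> 1" "\<forall>\<^sub>F n in sequentially. P n powr (1 - \<epsilon>) \<le> p n"
    and e: "0 < e"
  shows "\<forall>\<^sub>F n in sequentially. 1 - q - e < MMSE n (H n) (p n) / real (k n)"
proof -
  have "(\<lambda>n. 2 * sqrt ((real (k n) + 1) * P n powr ((\<epsilon> * q - \<eta>) * real (k n)))) \<longlonglongrightarrow> 2 * sqrt 0"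
    using \<eta> by (intro tendsto_mult tendsto_const tendsto_real_sqrt decay) simp
  then have "\<forall>\<^sub>F n in sequentially. 2 * sqrt ((real (k n) + 1) * P n powr ((\<epsilon> * q - \<eta>) * real (k n))) < e"
    by (rule order_tendstoD) (use e in simp)
  with eventually_overlap_bound[OF q \<eta>(1,2) l] eventually_graph eventually_p_1M p(2) show ?thesis
  proof eventually_elim
    case (elim n)
    then have "1 - q - 2 * sqrt (real (k n + 1) * P n powr ((\<epsilon> * q - \<eta>) * real (k n)))
      \<le> MMSE n (H n) (p n) / real (k n)"
      using MMSE_ratio_ge[of "H n" n "p n" q \<eta> \<epsilon>] p(1)[of n] q \<epsilon> by simp
    then show ?case using elim(5) by (simp add: add.commute)
  qed
qed

lemma flat_imp_AoN:
  assumes flat: "first_moment_flat H" and stable: "first_moment_stable H"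
  shows "AoN_at H P"
  unfolding AoN_at_def
proof (intro conjI allI impI)
  show "\<forall>\<^sub>F n in sequentially. 0 < P n \<and> P n < 1" by (rule eventually_p_1M)
  show "bounded_away_from_one P" by (rule bounded)
next
  fix \<epsilon> :: real and p :: "nat \<Rightarrow> real"
  assume \<epsilon>: "0 < \<epsilon>"
    and p: "(\<forall>n. 0 \<le> p n \<and> p n \<le> 1) \<and> (\<forall>\<^sub>F n in sequentially. P n powr (1 - \<epsilon>) \<le> p n)"
  show "(\<lambda>n. MMSE n (H n) (p n) / real (k n)) \<longlonglongrightarrow> 1"
  proof (rule order_tendstoI)
    fix a :: real assume "1 < a"
    show "\<forall>\<^sub>F n in sequentially. MMSE n (H n) (p n) / real (k n) < a"
      using eventually_graph
    proof eventually_elim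
      case (elim n)
      then have "MMSE n (H n) (p n) \<le> real (k n)" using MMSE_le[of "H n" n "p n"] p by simp
      then have "MMSE n (H n) (p n) / real (k n) \<le> 1" using elim by (simp add: divide_le_eq)
      then show ?case using \<open>1 < a\<close> by simp
    qed
  next
    fix a :: real assume "a < 1"
    define q where "q = min ((1 - a) / 2) (1 / 2)"
    have q: "0 < q" "q < 1" "q \<le> (1 - a) / 2" using \<open>a < 1\<close> by (auto simp: q_def min_def)
    define \<eta> where "\<eta> = min 1 (\<epsilon> * q / 2)"
    have eq: "0 < \<epsilon> * q" using \<epsilon> q by simp
    then have \<eta>: "0 < \<eta>" "\<eta> \<le> 1" "\<eta> < \<epsilon> * q" by (auto simp: \<eta>_def)
    have l: "\<forall>\<^sub>F n in sequentially. (1 - \<eta> / 2) * lambda n 1 (H n) \<le> lambda n q (H n)"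
      by (rule flat_lower[OF flat stable q(1,2)]) (use \<eta> in simp)
    have "\<forall>\<^sub>F n in sequentially. 1 - q - (1 - a) / 2 < MMSE n (H n) (p n) / real (k n)"
      using q p \<open>a < 1\<close> by (intro eventually_MMSE_ratio_ge[OF _ _ \<eta> \<epsilon> l]) auto
    then show "\<forall>\<^sub>F n in sequentially. a < MMSE n (H n) (p n) / real (k n)"
      by eventually_elim (use q(3) in \<open>simp add: field_simps\<close>)
  qed
next
  fix \<epsilon> :: real and p :: "nat \<Rightarrow> real"
  assume \<epsilon>: "0 < \<epsilon>"
    and p: "(\<forall>n. 0 \<le> p n \<and> p n \<le> 1) \<and> (\<forall>\<^sub>F n in sequentially. p n \<le> P n powr (1 + \<epsilon>))"
  show "(\<lambda>n. MMSE n (H n) (p n) / real (k n)) \<longlonglongrightarrow> 0"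
  proof (rule order_tendstoI)
    fix a :: real assume "a < 0"
    show "\<forall>\<^sub>F n in sequentially. a < MMSE n (H n) (p n) / real (k n)"
      using eventually_graph
    proof eventually_elim
      case (elim n)
      then have "0 \<le> MMSE n (H n) (p n)" using MMSE_nonneg[of "H n" n "p n"] p by simp
      then have "0 \<le> MMSE n (H n) (p n) / real (k n)" by simp
      then show ?case using \<open>a < 0\<close> by linarith
    qed
  next
    fix a :: real assume "0 < a"
    define d where "d = 1 - min (a / 2) (1 / 2)"
    have d: "0 \<le> d" "d < 1" "1 - d \<le> a / 2" using \<open>0 < a\<close> by (auto simp: d_def)
    define q where "q = \<epsilon> / (2 * (1 + \<epsilon>))"
    have q: "0 < q" "q < 1" "(1 + \<epsilon>) * q = \<epsilon> / 2" using \<epsilon> by (auto simp: q_def field_simps)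
    define \<eta> where "\<eta> = min 1 (\<epsilon> * (1 - d) / 2)"
    have ed: "0 < \<epsilon> * (1 - d)" using \<epsilon> d by simp
    then have \<eta>: "0 < \<eta>" "\<eta> \<le> 1" "\<eta> \<le> \<epsilon> * (1 - d) / 2" by (auto simp: \<eta>_def)
    define b where "b = min (\<epsilon> * (1 - d) / 2) (\<epsilon> / 2)"
    have b: "0 < b" "b \<le> \<epsilon> * (1 - d) - \<eta>" "b \<le> \<epsilon> - (1 + \<epsilon>) * q"
      using ed \<epsilon> \<eta> q(3) by (auto simp: b_def)
    have l: "\<forall>\<^sub>F n in sequentially. (1 - \<eta> / 2) * lambda n 1 (H n) \<le> lambda n q (H n)"
      by (rule flat_lower[OF flat stable q(1,2)]) (use \<eta> in simp)
    have ob: "\<forall>\<^sub>F n in sequentially. overlap_bound n (H n) q \<eta>"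
      using q \<eta> by (intro eventually_overlap_bound l) auto
    have small: "\<forall>\<^sub>F n in sequentially. (real (k n) + 1) * P n powr (b * real (k n)) < a / 2"
      using decay[OF b(1)] by (rule order_tendstoD) (use \<open>0 < a\<close> in simp)
    have pP: "\<forall>\<^sub>F n in sequentially. p n \<le> P n powr (1 + \<epsilon>)" using p by simp
    from ob small pP eventually_graph eventually_p_1M
    show "\<forall>\<^sub>F n in sequentially. MMSE n (H n) (p n) / real (k n) < a"
    proof eventually_elim
      case (elim n)
      then have "MMSE n (H n) (p n) / real (k n) \<le> (1 - d) + real (k n + 1) * P n powr (b * real (k n))"
        using MMSE_ratio_le[of "H n" n "p n" q \<eta> d \<epsilon> b] p d \<epsilon> b by simp
      then show ?case using elim(2) d(3) by (simp add: add.commute)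
    qed
  qed
qed

text \<open>AoN only speaks about sequences \<open>p\<close> that lie on one side of the critical window for all large \<open>n\<close>. Replacing
\<open>p n\<close> by 0 or 1 wherever it is on the wrong side gives such sequences, and hence a conclusion for each large \<open>n\<close>.\<close>

lemma AoN_localizes:
  assumes aon: "AoN_at H pc" and e: "0 < e" "e < 1" and u: "0 < u" and v: "v < 1"
    and p: "\<And>n. 0 \<le> p n \<and> p n \<le> 1"
  shows "\<forall>\<^sub>F n in sequentially.
    (u \<le> MMSE n (H n) (p n) / real (k n) \<longrightarrow> pc n powr (1 + e) < p n) \<and>
    (MMSE n (H n) (p n) / real (k n) \<le> v \<longrightarrow> p n < pc n powr (1 - e))"
proof -
  have pc: "\<forall>\<^sub>F n in sequentially. 0 < pc n \<and> pc n < 1" using aon by (simp add: AoN_at_def)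
  define p0 where "p0 n = (if p n \<le> pc n powr (1 + e) then p n else 0)" for n
  define p1 where "p1 n = (if pc n powr (1 - e) \<le> p n then p n else 1)" for n
  have "\<forall>\<^sub>F n in sequentially. p0 n \<le> pc n powr (1 + e)" by (simp add: p0_def)
  moreover have "\<forall>n. 0 \<le> p0 n \<and> p0 n \<le> 1" using p by (simp add: p0_def)
  ultimately have "(\<lambda>n. MMSE n (H n) (p0 n) / real (k n)) \<longlonglongrightarrow> 0"
    using aon e unfolding AoN_at_def by blast
  then have lo: "\<forall>\<^sub>F n in sequentially. MMSE n (H n) (p0 n) / real (k n) < u"
    by (rule order_tendstoD) (fact u)
  have "\<forall>\<^sub>F n in sequentially. pc n powr (1 - e) \<le> p1 n"
    using pc
  proof eventually_elim
    case (elim n)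
    have "pc n powr (1 - e) \<le> 1 powr (1 - e)" using elim e by (intro powr_mono2) auto
    then show ?case by (simp add: p1_def)
  qed
  moreover have "\<forall>n. 0 \<le> p1 n \<and> p1 n \<le> 1" using p by (simp add: p1_def)
  ultimately have "(\<lambda>n. MMSE n (H n) (p1 n) / real (k n)) \<longlonglongrightarrow> 1"
    using aon e unfolding AoN_at_def by blast
  then have hi: "\<forall>\<^sub>F n in sequentially. v < MMSE n (H n) (p1 n) / real (k n)"
    by (rule order_tendstoD) (fact v)
  from lo hi show ?thesis
    by eventually_elim (auto simp: p0_def p1_def split: if_splits)
qed

text \<open>Otherwise some subgraph \<open>J\<close> with at least \<open>q k\<close> edges has \<open>p\<^sub>1\<^sub>M(J) \<ge> P powr (1 - \<epsilon>)\<close> for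
infinitely many \<open>n\<close>. Between \<open>P\<close> and the threshold of \<open>J\<close> a positive
fraction of the planted copy can be recovered, so the relative error stays below 1, but not almost all of it, so
the error stays above 0. Two values \<open>P powr s1\<close> and
\<open>P powr s2\<close> in this range would both have to be \<open>p\<^sub>c powr (1 + o(1))\<close>.\<close>

lemma AoN_imp_ratio_one:
  assumes aon: "AoN_at H pc" and stable: "first_moment_stable H" and q: "0 < q" "q < 1"
  shows "(\<lambda>n. lambda n q (H n) / lambda n 1 (H n)) \<longlonglongrightarrow> 1"
proof (rule ccontr)
  assume neg: "\<not> ?thesis"
  have le1: "\<forall>\<^sub>F n in sequentially. lambda n q (H n) / lambda n 1 (H n) \<le> 1"
    using eventually_graph eventually_lambda_one_pos
  proof eventually_elim
    case (elim n)
    then show ?case using lambda_le_lambda_one[of "H n" q n] q by (simp add: divide_le_eq)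
  qed
  obtain \<epsilon>0 where \<epsilon>0: "0 < \<epsilon>0"
    "\<exists>\<^sub>F n in sequentially. \<epsilon>0 \<le> dist (lambda n q (H n) / lambda n 1 (H n)) 1"
    using neg by (auto simp: tendsto_iff not_eventually not_less)
  define \<epsilon> where "\<epsilon> = min \<epsilon>0 (1 / 2)"
  have \<epsilon>: "0 < \<epsilon>" "\<epsilon> \<le> 1 / 2" using \<epsilon>0 by (auto simp: \<epsilon>_def)
  have freq: "\<exists>\<^sub>F n in sequentially. lambda n q (H n) \<le> (1 - \<epsilon>) * lambda n 1 (H n)"
    using frequently_eventually_conj[OF \<epsilon>0(2) eventually_conj[OF le1 eventually_lambda_one_pos]]
  proof (rule frequently_elim1)
    fix n assume n: "(lambda n q (H n) / lambda n 1 (H n) \<le> 1 \<and> 0 < lambda n 1 (H n)) \<and>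
      \<epsilon>0 \<le> dist (lambda n q (H n) / lambda n 1 (H n)) 1"
    then have "lambda n q (H n) / lambda n 1 (H n) \<le> 1 - \<epsilon>"
      by (auto simp: dist_real_def \<epsilon>_def)
    then show "lambda n q (H n) \<le> (1 - \<epsilon>) * lambda n 1 (H n)"
      using n by (simp add: divide_le_eq)
  qed
  define d where "d = \<epsilon> * q / 8"
  have d: "0 < d" "d < 1" using \<epsilon> q mult_strict_mono[of \<epsilon> 1 q 1] by (auto simp: d_def)
  define \<eta> where "\<eta> = \<epsilon> / 16"
  have \<eta>: "0 < \<eta>" "\<eta> \<le> 1" using \<epsilon> by (auto simp: \<eta>_def)
  obtain q0 where q0: "1 / 2 < q0" "q0 < 1"
    "\<forall>\<^sub>F n in sequentially. (1 - \<eta> / 2) * lambda n 1 (H n) \<le> lambda n q0 (H n)"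
    using stable_lower[OF stable, of "\<eta> / 2"] \<eta> by auto
  \<comment> \<open>For the finitely many exceptional \<open>n\<close> the value is irrelevant, but it must be a probability.\<close>
  define p where "p s n = (if 0 < P n \<and> P n < 1 then P n powr s else 1)" for s n
  have p01: "0 \<le> p s n \<and> p s n \<le> 1" if "0 < s" for s n
    using that powr_le1[of s "P n"] by (auto simp: p_def)
  have pP: "\<forall>\<^sub>F n in sequentially. p s n = P n powr s" for s
    using eventually_p_1M by eventually_elim (simp add: p_def)
  define u where "u = (1 - q0) / 2"
  have u: "0 < u" using q0 by (simp add: u_def)
  have partial: "\<forall>\<^sub>F n in sequentially. u \<le> MMSE n (H n) (p s n) / real (k n) \<and>
      (lambda n q (H n) \<le> (1 - \<epsilon>) * lambda n 1 (H n) \<longrightarrow> MMSE n (H n) (p s n) / real (k n) \<le> 1 - d / 2)"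
    if s: "0 < s" "1 - \<epsilon> / 2 \<le> s" "s \<le> 1 - \<epsilon> / 4" for s
  proof -
    have "\<eta> < (1 - s) * q0"
    proof -
      have "\<epsilon> / 4 * (1 / 2) \<le> (1 - s) * q0" using s q0 \<epsilon> by (intro mult_mono) auto
      then show ?thesis using \<epsilon> by (simp add: \<eta>_def)
    qed
    moreover have "\<forall>\<^sub>F n in sequentially. P n powr (1 - (1 - s)) \<le> p s n"
      using pP[of s] by eventually_elim simp
    ultimately have lo: "\<forall>\<^sub>F n in sequentially. 1 - q0 - u < MMSE n (H n) (p s n) / real (k n)"
      using q0 \<eta> s \<epsilon> u p01 by (intro eventually_MMSE_ratio_ge[of q0 \<eta> "1 - s"]) auto
    have a: "0 < \<epsilon> * q / 4" using \<epsilon> q by simp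
    have small: "\<forall>\<^sub>F n in sequentially. (real (k n) + 1) * P n powr (\<epsilon> * q / 4 * real (k n)) < d / 2"
      using decay[OF a] by (rule order_tendstoD) (use d in simp)
    from lo small pP[of s] eventually_graph eventually_p_1M show ?thesis
    proof eventually_elim
      case (elim n)
      have "MMSE n (H n) (p s n) / real (k n) \<le> 1 - d / 2"
        if lam: "lambda n q (H n) \<le> (1 - \<epsilon>) * lambda n 1 (H n)"
      proof -
        have q1: "q \<le> 1" using q by simp
        have G: "simple_graph (H n)" "no_isolated_vertices (H n)" "num_verts (H n) \<le> n" "1 \<le> k n"
          using elim by auto
        obtain J where J: "subgraph J (H n)" "max 1 (q * real (k n)) \<le> real (num_edges J)"
          "psi n q (H n) = p_1M n J"
          using psi_attained[OF G(1,4) q1] .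
        have sJ: "simple_graph J" using J(1) by (simp add: subgraph_def)
        have "P n powr (1 - \<epsilon>) \<le> p_1M n J"
          using psi_le_powr(2)[OF G(1,2,4) q1] lam J(3) by simp
        then have "p_1M n J powr (- real (num_edges J)) \<le> (P n powr (1 - \<epsilon>)) powr (- real (num_edges J))"
          using elim by (intro powr_mono2') auto
        then have cc: "copy_count n J \<le> P n powr (- (1 - \<epsilon>) * real (num_edges J))"
          using copy_count_eq_powr[OF sJ, of n] J(2) by (simp add: powr_powr algebra_simps)
        have "MMSE n (H n) (p s n) / real (k n) \<le> (1 - d) +
            P n powr ((s - (1 - \<epsilon>)) * real (num_edges J) - s * d * real (k n))"
          using elim p01[OF s(1), of n] d s
          by (intro MMSE_ratio_le_subgraph[OF G _ _ J(1) _ _ _ _ _ cc]) auto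
        also have "P n powr ((s - (1 - \<epsilon>)) * real (num_edges J) - s * d * real (k n))
            \<le> P n powr (\<epsilon> * q / 4 * real (k n))"
        proof (rule powr_mono')
          have "\<epsilon> / 2 * (q * real (k n)) \<le> (s - (1 - \<epsilon>)) * real (num_edges J)"
            using s J(2) \<epsilon> q by (intro mult_mono) auto
          moreover have "s * d * real (k n) \<le> 1 * d * real (k n)"
            using s d \<epsilon> by (intro mult_right_mono) auto
          moreover have "d * real (k n) = \<epsilon> * (q * real (k n)) / 8" by (simp add: d_def)
          moreover have "\<epsilon> * q / 4 * real (k n) = \<epsilon> * (q * real (k n)) / 4" by simp
          moreover have "0 \<le> \<epsilon> * (q * real (k n))" using \<epsilon> q by simp
          ultimately show "\<epsilon> * q / 4 * real (k n)
              \<le> (s - (1 - \<epsilon>)) * real (num_edges J) - s * d * real (k n)"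
            by linarith
        qed (use elim in auto)
        also have "\<dots> \<le> (real (k n) + 1) * P n powr (\<epsilon> * q / 4 * real (k n))"
          by (simp add: mult_right_le_one_le distrib_right)
        finally show ?thesis using elim(2) by linarith
      qed
      then show ?case using elim(1) by (simp add: u_def field_simps)
    qed
  qed
  \<comment> \<open>This width makes \<open>s1 (1 - e) > s2 (1 + e)\<close>, so \<open>P powr s1\<close> and \<open>P powr s2\<close> do not fit into one window.\<close>
  define e where "e = \<epsilon> / 8"
  have e: "0 < e" "e < 1" using \<epsilon> by (auto simp: e_def)
  define s1 where "s1 = 1 - \<epsilon> / 4"
  define s2 where "s2 = 1 - \<epsilon> / 2"
  have s: "0 < s1" "0 < s2" "1 - \<epsilon> / 2 \<le> s1" "s1 \<le> 1 - \<epsilon> / 4"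
    "1 - \<epsilon> / 2 \<le> s2" "s2 \<le> 1 - \<epsilon> / 4" using \<epsilon> by (auto simp: s1_def s2_def)
  have v: "1 - d / 2 < 1" using d by simp
  have pc: "\<forall>\<^sub>F n in sequentially. 0 < pc n \<and> pc n < 1" using aon by (simp add: AoN_at_def)
  have loc: "\<forall>\<^sub>F n in sequentially.
      (u \<le> MMSE n (H n) (p s n) / real (k n) \<longrightarrow> pc n powr (1 + e) < p s n) \<and>
      (MMSE n (H n) (p s n) / real (k n) \<le> 1 - d / 2 \<longrightarrow> p s n < pc n powr (1 - e))"
    if "0 < s" for s
    by (rule AoN_localizes[OF aon e u v]) (use p01[OF that] in blast)
  have "\<forall>\<^sub>F n in sequentially. \<not> lambda n q (H n) \<le> (1 - \<epsilon>) * lambda n 1 (H n)"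
    using partial[OF s(1,3,4)] partial[OF s(2,5,6)] pP[of s1] pP[of s2] pc eventually_p_1M
      loc[OF s(1)] loc[OF s(2)]
  proof eventually_elim
    case (elim n)
    show ?case
    proof
      assume lam: "lambda n q (H n) \<le> (1 - \<epsilon>) * lambda n 1 (H n)"
      have ln_powr: "ln (pc n powr x) = x * ln (pc n)" "ln (P n powr x) = x * ln (P n)" for x
        using elim by (simp_all add: ln_powr)
      have pos: "0 < pc n powr x" "0 < P n powr x" for x using elim by simp_all
      have "pc n powr (1 + e) < P n powr s1" "P n powr s2 < pc n powr (1 - e)"
        using elim lam by auto
      then have "ln (pc n powr (1 + e)) < ln (P n powr s1)" "ln (P n powr s2) < ln (pc n powr (1 - e))"
        using pos by (simp_all only: ln_less_cancel_iff)
      then have ln: "(1 + e) * ln (pc n) < s1 * ln (P n)" "s2 * ln (P n) < (1 - e) * ln (pc n)"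
        by (simp_all only: ln_powr)
      have "s2 * ((1 + e) * ln (pc n)) < s2 * (s1 * ln (P n))"
        using ln(1) s(2) by (rule mult_strict_left_mono)
      moreover have "s1 * (s2 * ln (P n)) < s1 * ((1 - e) * ln (pc n))"
        using ln(2) s(1) by (rule mult_strict_left_mono)
      ultimately have "0 < (s1 * (1 - e) - s2 * (1 + e)) * ln (pc n)"
        by (simp add: algebra_simps)
      moreover have "0 < s1 * (1 - e) - s2 * (1 + e)"
      proof -
        have "s1 * (1 - e) - s2 * (1 + e) = 3 * (\<epsilon> * \<epsilon>) / 32"
          by (simp add: s1_def s2_def e_def field_simps)
        moreover have "0 < \<epsilon> * \<epsilon>" using \<epsilon> by simp
        ultimately show ?thesis by linarith
      qed
      moreover have "ln (pc n) < 0" using elim by simp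
      ultimately show False by (simp add: zero_less_mult_iff)
    qed
  qed
  then show False using freq by (simp add: frequently_def)
qed

lemma AoN_imp_flat:
  assumes aon: "AoN_at H pc" and stable: "first_moment_stable H"
  shows "first_moment_flat H"
  unfolding first_moment_flat_def
proof (intro ballI)
  fix q q' :: real assume q: "q \<in> {0<..<1}" "q' \<in> {0<..<1}"
  have "(\<lambda>n. (lambda n q (H n) / lambda n 1 (H n)) / (lambda n q' (H n) / lambda n 1 (H n))) \<longlonglongrightarrow> 1 / 1"
    using q by (intro tendsto_divide AoN_imp_ratio_one[OF aon stable]) auto
  moreover have "\<forall>\<^sub>F n in sequentially.
      (lambda n q (H n) / lambda n 1 (H n)) / (lambda n q' (H n) / lambda n 1 (H n))
      = lambda n q (H n) / lambda n q' (H n)"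
    using eventually_lambda_one_pos by eventually_elim simp
  ultimately have "(\<lambda>n. lambda n q (H n) / lambda n q' (H n)) \<longlonglongrightarrow> 1 / 1"
    by (rule Lim_transform_eventually)
  then show "(\<lambda>n. lambda n q (H n) / lambda n q' (H n)) \<longlonglongrightarrow> 1" by simp
qed

end

end

theorem theorem5p3:
  fixes H :: "nat \<Rightarrow> 'a graph"
  assumes "\<And>n. n \<ge> 1 \<Longrightarrow> simple_graph (H n)"
    and "\<And>n. n \<ge> 1 \<Longrightarrow> no_isolated_vertices (H n)"
    and "\<And>n. n \<ge> 1 \<Longrightarrow> num_verts (H n) \<le> n"
    and "filterlim (\<lambda>n. num_edges (H n)) at_top sequentially"
    and "bounded_away_from_one (\<lambda>n. p_1M n (H n))"
    and "first_moment_stable H"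
    and "(\<lambda>n. p_1M n (H n)) \<longlonglongrightarrow> 0 \<or>
         (\<exists>\<delta> :: nat \<Rightarrow> real. \<delta> \<longlonglongrightarrow> 0 \<and>
            (\<forall>\<^sub>F n in sequentially. real (num_verts (H n)) \<le> real n powr \<delta> n))"
  shows "(AoN_occurs H \<longleftrightarrow> first_moment_flat H) \<and>
         (first_moment_flat H \<longrightarrow> AoN_at H (\<lambda>n. p_1M n (H n)))"
proof -
  note std = assms(1-5,7)
  have "AoN_at H (\<lambda>n. p_1M n (H n))" if "first_moment_flat H"
    by (rule flat_imp_AoN[OF std that assms(6)])
  moreover have "first_moment_flat H" if "AoN_at H pc" for pc
    by (rule AoN_imp_flat[OF std that assms(6)])
  ultimately show ?thesis unfolding AoN_occurs_def by blast
qed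

end
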